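(* Let $G$ be an $n$-vertex graph with maximum degree at most $4$. Then $f_{ce}(G)\leq n-1$; that is, $E(G)$ can be partitioned into at most $n-1$ sets, each of which is the edge set of a cycle of $G$ or consists of a single edge.
   Context: Graphs are finite and simple, with at least one vertex. A decomposition of $G=(V,E)$ into cycles and edges is a partition $E_1,\dots,E_k$ of $E$ such that each subgraph $H_i=(V(E_i),E_i)$ is a cycle or a single edge, where $V(E_i)$ is the set of vertices incident to edges in $E_i$ (the empty partition, $k=0$, is used if $E=\emptyset$). $f_{ce}(G)$ denotes the minimum number $k$ of subgraphs in a decomposition of $G$ into cycles and edges. *)

theory Defs
  imports "HOL-Library.Disjoint_Sets"
begin

text \<open>
  A finite simple graph is given by its vertex set \<open>V\<close> and its edge set \<open>E\<close>, whose members are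
  two-element subsets of \<open>V\<close>.
\<close>

locale simple_graph =
  fixes V :: "'a set" and E :: "'a set set"
  assumes finite_verts: "finite V"
    and verts_nonempty: "V \<noteq> {}"
    and edges: "e \<in> E \<Longrightarrow> e \<subseteq> V \<and> card e = 2"

definition degree :: "'a set set \<Rightarrow> 'a \<Rightarrow> nat" where
  "degree E v = card {e \<in> E. v \<in> e}"

text \<open>The maximum is meaningful only for finite nonempty \<open>V\<close>, as in \<open>simple_graph\<close>.\<close>

definition max_degree :: "'a set \<Rightarrow> 'a set set \<Rightarrow> nat" where
  "max_degree V E = Max (degree E ` V)"

text \<open>
  The graph \<open>(V, E)\<close> is a cycle \<open>v\<^sub>0 v\<^sub>1 \<dots> v\<^sub>m\<^sub>-\<^sub>1 v\<^sub>0\<close> on \<open>m \<ge> 3\<close> distinct vertices.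
\<close>

definition is_cycle :: "'a set \<Rightarrow> 'a set set \<Rightarrow> bool" where
  "is_cycle V E \<longleftrightarrow>
     (\<exists>vs. distinct vs \<and> length vs \<ge> 3 \<and> V = set vs \<and>
           E = {{vs ! i, vs ! (Suc i mod length vs)} | i. i < length vs})"

definition is_single_edge :: "'a set \<Rightarrow> 'a set set \<Rightarrow> bool" where
  "is_single_edge V E \<longleftrightarrow> (\<exists>u v. u \<noteq> v \<and> V = {u, v} \<and> E = {{u, v}})"

text \<open>
  The set of vertices incident to an edge of \<open>F\<close> is \<open>\<Union>F\<close>.  Blocks of a \<open>partition_on\<close> are
  nonempty, and the only partition of the empty edge set is the empty one.
\<close>

definition ce_decomposition :: "'a set set \<Rightarrow> 'a set set set \<Rightarrow> bool" where
  "ce_decomposition E P \<longleftrightarrow>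
     partition_on E P \<and> (\<forall>F\<in>P. is_cycle (\<Union>F) F \<or> is_single_edge (\<Union>F) F)"

definition f_ce :: "'a set set \<Rightarrow> nat" where
  "f_ce E = (LEAST k. \<exists>P. ce_decomposition E P \<and> card P = k)"

context simple_graph
begin

lemma finite_edges: "finite E"
  using finite_verts edges by (meson PowI finite_Pow_iff rev_finite_subset subsetI)

text \<open>The minimum in \<open>f_ce\<close> is over a nonempty set, since all edges may be taken singly.\<close>

lemma ce_decomposition_singletons: "ce_decomposition E ((\<lambda>e. {e}) ` E)"
proof -
  have "partition_on E ((\<lambda>e. {e}) ` E)"
    by (auto simp: partition_on_def disjoint_def)
  moreover have "is_single_edge (\<Union>{e}) {e}" if "e \<in> E" for e
    using edges[OF that] by (auto simp: is_single_edge_def card_2_iff)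
  ultimately show ?thesis
    by (auto simp: ce_decomposition_def)
qed

lemma f_ce_attained: "\<exists>P. ce_decomposition E P \<and> finite P \<and> card P = f_ce E"
proof -
  have "\<exists>P. ce_decomposition E P \<and> card P = f_ce E"
    unfolding f_ce_def by (rule LeastI_ex) (use ce_decomposition_singletons in blast)
  then show ?thesis
    using finite_edges finite_elements by (auto simp: ce_decomposition_def)
qed

lemma f_ce_le: "ce_decomposition E P \<Longrightarrow> f_ce E \<le> card P"
  unfolding f_ce_def by (rule Least_le) blast

end

end

theory Submission
  imports Defs
begin

text \<open>
  One shows \<open>f\<^sub>c\<^sub>e \<le> n - c\<close>, where \<open>c\<close> is the number of components, by induction on the number of
  edges. In a minimal counterexample, removing \<open>k\<close> disjoint cycles and edges increases \<open>c\<close> by less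
  than \<open>k\<close>. So there are no bridges, removing a cycle disconnects nothing, and every degree is
  \<open>0\<close>, \<open>3\<close> or \<open>4\<close>. Choose a cycle \<open>C\<close> and a connected set \<open>R\<close> of other vertices in the same component,
  with \<open>R\<close> as large as possible; then every vertex of \<open>C\<close> has a neighbour in \<open>R\<close>.

  Let \<open>H\<close> be the graph without the edges of \<open>C\<close>. Two vertices of \<open>C\<close> are always separated by a
  bridge of \<open>H\<close>: otherwise they lie on a closed trail \<open>X\<close> of \<open>H\<close>, which consists of at most \<open>1 + d\<close>
  cycles, \<open>d\<close> being the number of vertices of degree 4 on \<open>X\<close>, and removing \<open>C\<close> and \<open>X\<close> isolates these
  \<open>d\<close> vertices and the two given ones. On the other hand, two neighbours on \<open>C\<close> are separated by only
  one bridge. Some bridge \<open>b\<close> cuts off a single vertex \<open>x\<close> of \<open>C\<close>. Then \<open>b\<close> is the only bridge between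
  \<open>x\<close> and either of its neighbours \<open>y\<close>, \<open>z\<close> on \<open>C\<close>, so no bridge separates \<open>y\<close> from \<open>z\<close>.
\<close>

subsection \<open>Walks and connectivity\<close>

text \<open>A list, so that \<open>distinct (walk_edges w)\<close> can say that a walk repeats no
  edge.\<close>

fun walk_edges :: "'a list \<Rightarrow> 'a set list" where
  "walk_edges (x # y # zs) = {x, y} # walk_edges (y # zs)"
| "walk_edges _ = []"

lemma walk_edges_append:
  "walk_edges (xs @ y # ys) = walk_edges (xs @ [y]) @ walk_edges (y # ys)"
proof (induction xs)
  case (Cons a xs)
  then show ?case by (cases xs) auto
qed simp

lemma walk_edges_snoc: "xs \<noteq> [] \<Longrightarrow> walk_edges (xs @ [y]) = walk_edges xs @ [{last xs, y}]"
  by (induction xs rule: walk_edges.induct) auto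

lemma walk_edges_Cons: "xs \<noteq> [] \<Longrightarrow> walk_edges (y # xs) = {y, hd xs} # walk_edges xs"
  by (cases xs) auto

lemma walk_edges_rev: "walk_edges (rev xs) = rev (walk_edges xs)"
proof (induction xs rule: walk_edges.induct)
  case (1 x y zs)
  then show ?case
    using walk_edges_append[of "rev zs" y "[x]"] by (simp add: insert_commute)
qed auto

lemma set_walk_edges: "set (walk_edges xs) = {{xs ! i, xs ! Suc i} | i. Suc i < length xs}"
proof (induction xs rule: walk_edges.induct)
  case (1 x y zs)
  show ?case
  proof (intro equalityI subsetI)
    fix e assume "e \<in> set (walk_edges (x # y # zs))"
    then consider "e = {x, y}" | i where "e = {(y # zs) ! i, (y # zs) ! Suc i}" "Suc i < length (y # zs)"
      using 1 by auto
    then show "e \<in> {{(x # y # zs) ! i, (x # y # zs) ! Suc i} | i. Suc i < length (x # y # zs)}"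
    proof cases
      case 1
      then show ?thesis by (auto intro!: exI[of _ 0])
    next
      case (2 i)
      then show ?thesis by (auto intro!: exI[of _ "Suc i"])
    qed
  next
    fix e assume "e \<in> {{(x # y # zs) ! i, (x # y # zs) ! Suc i} | i. Suc i < length (x # y # zs)}"
    then obtain i where i: "e = {(x # y # zs) ! i, (x # y # zs) ! Suc i}"
      "Suc i < length (x # y # zs)" by blast
    then show "e \<in> set (walk_edges (x # y # zs))"
      using 1 by (cases i) auto
  qed
qed auto

lemma walk_edges_subset: "e \<in> set (walk_edges xs) \<Longrightarrow> e \<subseteq> set xs"
  by (induction xs rule: walk_edges.induct) auto

lemma Union_walk_edges: "length xs \<ge> 2 \<Longrightarrow> \<Union> (set (walk_edges xs)) = set xs"
proof (induction xs rule: walk_edges.induct)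
  case (1 x y zs)
  then show ?case by (cases zs) auto
qed auto

lemma distinct_walk_edges: "distinct xs \<Longrightarrow> distinct (walk_edges xs)"
proof (induction xs rule: walk_edges.induct)
  case (1 x y zs)
  then have "{x, y} \<notin> set (walk_edges (y # zs))"
    using walk_edges_subset[of "{x, y}" "y # zs"] by auto
  with 1 show ?case by simp
qed auto

lemma card_walk_edges: "distinct xs \<Longrightarrow> e \<in> set (walk_edges xs) \<Longrightarrow> card e = 2"
  by (induction xs rule: walk_edges.induct) auto

text \<open>Reflexive on the whole type, so that an isolated vertex forms a component of its
  own.\<close>

definition conn :: "'a set set \<Rightarrow> 'a \<Rightarrow> 'a \<Rightarrow> bool" where
  "conn E = (\<lambda>x y. {x, y} \<in> E)\<^sup>*\<^sup>*"

lemma conn_refl [simp]: "conn E x x"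
  by (simp add: conn_def)

lemma conn_edge: "{x, y} \<in> E \<Longrightarrow> conn E x y"
  by (auto simp: conn_def)

lemma conn_trans: "conn E x y \<Longrightarrow> conn E y z \<Longrightarrow> conn E x z"
  by (auto simp: conn_def)

lemma conn_sym: "conn E x y \<Longrightarrow> conn E y x"
  unfolding conn_def
proof (induction rule: rtranclp_induct)
  case (step y z)
  then have "{z, y} \<in> E" by (simp add: insert_commute)
  then show ?case using step.IH by (rule converse_rtranclp_into_rtranclp)
qed simp

lemma conn_common: "conn E r x \<Longrightarrow> conn E r y \<Longrightarrow> conn E x y"
  by (rule conn_trans[OF conn_sym])

lemma conn_mono:
  assumes "conn E x y" "E \<subseteq> E'"
  shows "conn E' x y"
proof -
  have "(\<lambda>x y. {x, y} \<in> E)\<^sup>*\<^sup>* \<le> (\<lambda>x y. {x, y} \<in> E')\<^sup>*\<^sup>*"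
    by (rule rtranclp_mono) (use assms(2) in blast)
  then show ?thesis using assms(1) unfolding conn_def by blast
qed

lemma conn_closed:
  assumes "conn E x y" "x \<in> A" "\<And>a b. {a, b} \<in> E \<Longrightarrow> a \<in> A \<Longrightarrow> b \<in> A"
  shows "y \<in> A"
  using assms(1) unfolding conn_def
  by (induction rule: rtranclp_induct) (use assms(2,3) in auto)

lemma conn_exit:
  assumes "conn E x y" "x \<in> A" "y \<notin> A"
  obtains a b where "{a, b} \<in> E" "a \<in> A" "b \<notin> A"
  using conn_closed[OF assms(1,2)] assms(3) by blast

lemma conn_walk:
  assumes "set (walk_edges w) \<subseteq> E" "x \<in> set w" "y \<in> set w"
  shows "conn E x y"
proof -
  have *: "\<forall>y \<in> set w. conn E (hd w) y" if "set (walk_edges w) \<subseteq> E" for w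
    using that
  proof (induction w rule: walk_edges.induct)
    case (1 x y zs)
    then have "conn E x y" by (auto intro: conn_edge)
    with 1 show ?case by (auto intro: conn_trans)
  qed auto
  show ?thesis
    using *[OF assms(1)] assms(2,3) conn_sym conn_trans by metis
qed

lemma conn_obtain_path:
  assumes "conn E x y"
  obtains p where "p \<noteq> []" "hd p = x" "last p = y" "distinct p" "set (walk_edges p) \<subseteq> E"
proof -
  have "\<exists>p. p \<noteq> [] \<and> hd p = x \<and> last p = y \<and> distinct p \<and> set (walk_edges p) \<subseteq> E"
    using assms unfolding conn_def
  proof (induction rule: rtranclp_induct)
    case base
    show ?case by (rule exI[of _ "[x]"]) simp
  next
    case (step y z)
    then obtain p where p: "p \<noteq> []" "hd p = x" "last p = y" "distinct p"
      "set (walk_edges p) \<subseteq> E" by blast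
    show ?case
    proof (cases "z \<in> set p")
      case True
      then obtain a b where ab: "p = a @ z # b" by (meson split_list)
      show ?thesis
      proof (rule exI[of _ "a @ [z]"], intro conjI)
        show "hd (a @ [z]) = x" using p(2) ab by (cases a) auto
        show "set (walk_edges (a @ [z])) \<subseteq> E"
          using p(5) ab walk_edges_append[of a z b] by auto
      qed (use p ab in auto)
    next
      case False
      then show ?thesis
        using p step(2) by (intro exI[of _ "p @ [z]"]) (auto simp: walk_edges_snoc)
    qed
  qed
  then show ?thesis using that by blast
qed

text \<open>A path is cut at its first vertex in \<open>A\<close>. The part \<open>p\<close> before
  that vertex is empty exactly when \<open>x\<close> itself lies in \<open>A\<close>.\<close>

lemma conn_obtain_path_until:
  assumes "conn E x y" "y \<in> A"
  obtains p z where "p = [] \<or> hd p = x" "p = [] \<Longrightarrow> z = x" "z \<in> A" "set p \<inter> A = {}"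
    "distinct (p @ [z])" "set (walk_edges (p @ [z])) \<subseteq> E"
proof -
  obtain q where q: "q \<noteq> []" "hd q = x" "last q = y" "distinct q" "set (walk_edges q) \<subseteq> E"
    using conn_obtain_path[OF assms(1)] .
  then have "\<exists>v\<in>set q. v \<in> A" using assms(2) last_in_set by metis
  then obtain p z r where pz: "q = p @ z # r" "z \<in> A" "\<forall>v\<in>set p. v \<notin> A"
    using split_list_first_prop[of q "\<lambda>v. v \<in> A"] by blast
  show ?thesis
  proof (rule that[of p z])
    show "p = [] \<or> hd p = x" using q(2) pz(1) by (cases p) auto
    show "z = x" if "p = []" using q(2) pz(1) that by auto
    show "set (walk_edges (p @ [z])) \<subseteq> E"
      using q(5) pz(1) walk_edges_append[of p z r] by auto
  qed (use q pz in auto)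
qed

subsection \<open>Degrees\<close>

lemma degree_mono: "finite F \<Longrightarrow> E \<subseteq> F \<Longrightarrow> degree E v \<le> degree F v"
  unfolding degree_def by (rule card_mono) auto

lemma degree_Un_disjoint:
  assumes "finite E" "finite F" "E \<inter> F = {}"
  shows "degree (E \<union> F) v = degree E v + degree F v"
proof -
  have "{e \<in> E \<union> F. v \<in> e} = {e \<in> E. v \<in> e} \<union> {e \<in> F. v \<in> e}" by auto
  then show ?thesis
    using assms unfolding degree_def by (simp add: card_Un_disjoint disjoint_iff)
qed

lemma degree_ge_card: "finite E \<Longrightarrow> F \<subseteq> E \<Longrightarrow> (\<And>e. e \<in> F \<Longrightarrow> v \<in> e) \<Longrightarrow> card F \<le> degree E v"
  unfolding degree_def by (rule card_mono) auto

lemma degree_pos: "finite E \<Longrightarrow> e \<in> E \<Longrightarrow> v \<in> e \<Longrightarrow> degree E v > 0"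
  by (auto simp: degree_def card_gt_0_iff)

lemma degree_0_conn:
  assumes "finite E" "degree E v = 0" "conn E v w"
  shows "w = v"
proof -
  have "w \<in> {v}"
    by (rule conn_closed[OF assms(3)]) (use assms(1,2) degree_pos in fastforce)+
  then show ?thesis by simp
qed

text \<open>The base vertex is listed at both ends and vertices may repeat. The length bound
  excludes the trivial walk, the cardinality condition excludes loops.\<close>

definition closed_trail :: "'a list \<Rightarrow> bool" where
  "closed_trail w \<longleftrightarrow> length w \<ge> 2 \<and> hd w = last w \<and> distinct (walk_edges w)
     \<and> (\<forall>e\<in>set (walk_edges w). card e = 2)"

lemma closed_trail_obtain:
  assumes "closed_trail w"
  obtains x m where "w = x # m @ [x]"
proof -
  obtain x w' where w': "w = x # w'" "w' \<noteq> []"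
  proof (cases w)
    case (Cons x w')
    moreover have "w' \<noteq> []" using assms Cons by (auto simp: closed_trail_def)
    ultimately show ?thesis using that by blast
  qed (use assms in \<open>auto simp: closed_trail_def\<close>)
  then have "last w' = x" using assms by (auto simp: closed_trail_def)
  then show ?thesis using that[of x "butlast w'"] w' by (metis append_butlast_last_id)
qed

text \<open>The trail enters and leaves \<open>v\<close> by different edges. At the base vertex
  these are its last and its first edge.\<close>

lemma closed_trail_degree:
  assumes w: "closed_trail w" and v: "v \<in> set w"
  shows "degree (set (walk_edges w)) v \<ge> 2"
proof -
  have "\<exists>e f. e \<in> set (walk_edges w) \<and> f \<in> set (walk_edges w) \<and> e \<noteq> f \<and> v \<in> e \<and> v \<in> f"
  proof (cases "v = hd w")
    case True
    obtain m where m: "w = v # m @ [v]"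
      using closed_trail_obtain[OF w] True by (metis list.sel(1))
    moreover have "m \<noteq> []" using w m by (auto simp: closed_trail_def)
    ultimately have "walk_edges w = {v, hd m} # walk_edges m @ [{last m, v}]"
      by (simp add: walk_edges_Cons walk_edges_snoc)
    then show ?thesis using w
      by (intro exI[of _ "{v, hd m}"] exI[of _ "{last m, v}"]) (auto simp: closed_trail_def)
  next
    case False
    obtain a b where ab: "w = a @ v # b" using v by (meson split_list)
    have "a \<noteq> []" using False ab by auto
    moreover have "b \<noteq> []" using False ab w by (auto simp: closed_trail_def)
    ultimately have "walk_edges w = walk_edges a @ {last a, v} # {v, hd b} # walk_edges b"
      using ab walk_edges_append[of a v b] by (simp add: walk_edges_Cons walk_edges_snoc)
    then show ?thesis using w
      by (intro exI[of _ "{v, hd b}"] exI[of _ "{last a, v}"]) (auto simp: closed_trail_def)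
  qed
  then obtain e f where "{e, f} \<subseteq> set (walk_edges w)" "e \<noteq> f" "v \<in> e" "v \<in> f" by blast
  then have "card {e, f} \<le> degree (set (walk_edges w)) v"
    by (intro degree_ge_card) auto
  then show ?thesis using \<open>e \<noteq> f\<close> by simp
qed

subsection \<open>Decompositions\<close>

text \<open>Finiteness is demanded because an infinite set has cardinality 0.\<close>

definition decomposable :: "'a set set \<Rightarrow> nat \<Rightarrow> bool" where
  "decomposable E k \<longleftrightarrow> (\<exists>P. ce_decomposition E P \<and> finite P \<and> card P \<le> k)"

lemma decomposable_mono: "decomposable E k \<Longrightarrow> k \<le> l \<Longrightarrow> decomposable E l"
  unfolding decomposable_def by (meson le_trans)

lemma decomposable_empty: "decomposable {} 0"
  unfolding decomposable_def ce_decomposition_def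
  by (rule exI[of _ "{}"]) (auto simp: partition_on_def)

lemma decomposable_Un:
  assumes "decomposable E k" "decomposable F l" "E \<inter> F = {}"
  shows "decomposable (E \<union> F) (k + l)"
proof -
  obtain P Q where P: "ce_decomposition E P" "finite P" "card P \<le> k"
    and Q: "ce_decomposition F Q" "finite Q" "card Q \<le> l"
    using assms unfolding decomposable_def by blast
  have "partition_on (E \<union> F) (P \<union> Q)"
    using P(1) Q(1) assms(3) unfolding ce_decomposition_def partition_on_def
    by (auto intro!: disjoint_union)
  then have "ce_decomposition (E \<union> F) (P \<union> Q)"
    using P(1) Q(1) unfolding ce_decomposition_def by blast
  moreover have "card (P \<union> Q) \<le> k + l"
    using card_Un_le[of P Q] P(3) Q(3) by linarith
  ultimately show ?thesis using P(2) Q(2) unfolding decomposable_def by blast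
qed

lemma decomposable_single_block:
  assumes "E \<noteq> {}" "is_cycle (\<Union>E) E \<or> is_single_edge (\<Union>E) E"
  shows "decomposable E 1"
  unfolding decomposable_def ce_decomposition_def
  by (rule exI[of _ "{E}"]) (use assms in \<open>auto simp: partition_on_def disjoint_def\<close>)

lemma decomposable_edge: "x \<noteq> y \<Longrightarrow> decomposable {{x, y}} 1"
  by (rule decomposable_single_block) (auto simp: is_single_edge_def)

section \<open>Cycles as lists of distinct vertices\<close>

definition cycle_list :: "'a list \<Rightarrow> bool" where
  "cycle_list vs \<longleftrightarrow> distinct vs \<and> length vs \<ge> 3"

definition cycle_edges :: "'a list \<Rightarrow> 'a set set" where
  "cycle_edges vs = set (walk_edges (vs @ [hd vs]))"

lemma cycle_edges_Cons: "cycle_edges (x # vs) = set (walk_edges (x # vs @ [x]))"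
  by (simp add: cycle_edges_def)

text \<open>The two arcs between \<open>x\<close> and \<open>y\<close>. For \<open>b = []\<close>
  the second arc is the single edge from \<open>y\<close> to \<open>x\<close>.\<close>

lemma cycle_edges_split:
  "cycle_edges (x # a @ y # b) = set (walk_edges (x # a @ [y])) \<union> set (walk_edges (y # b @ [x]))"
  using walk_edges_append[of "x # a" y "b @ [x]"] by (simp add: cycle_edges_Cons)

lemma cycle_edges_rotate: "cycle_edges (a @ b) = cycle_edges (b @ a)"
proof (cases a; cases b)
  fix x a' y b' assume "a = x # a'" "b = y # b'"
  then show ?thesis using cycle_edges_split[of x a' y b'] cycle_edges_split[of y b' x a'] by auto
qed auto

lemma cycle_edges_subset: "e \<in> cycle_edges vs \<Longrightarrow> e \<subseteq> set vs"
  unfolding cycle_edges_def using walk_edges_subset[of e "vs @ [hd vs]"]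
  by (cases vs) auto

lemma cycle_edges_nonempty: "vs \<noteq> [] \<Longrightarrow> cycle_edges vs \<noteq> {}"
  unfolding cycle_edges_def by (cases vs) (auto simp: walk_edges_Cons)

text \<open>Only the two edges at the base vertex could coincide, and with at least three vertices
  their other ends differ.\<close>

lemma cycle_list_closed_trail:
  assumes "cycle_list vs"
  shows "closed_trail (vs @ [hd vs])"
proof -
  obtain x vs' where vs: "vs = x # vs'" using assms by (cases vs) (auto simp: cycle_list_def)
  obtain y vs'' where vs': "vs' = y # vs''"
    using assms vs by (cases vs') (auto simp: cycle_list_def)
  have ne: "vs'' \<noteq> []" using assms vs vs' by (auto simp: cycle_list_def)
  have e: "walk_edges (vs @ [hd vs]) = {x, y} # walk_edges vs' @ [{last vs', x}]"
    using vs vs' walk_edges_snoc[of vs' x] by simp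
  have d: "distinct vs" using assms by (simp add: cycle_list_def)
  have "last vs' \<noteq> y" "last vs' \<in> set vs'" using d vs vs' ne by auto
  then have "{x, y} \<noteq> {last vs', x}" using d vs by (auto simp: doubleton_eq_iff)
  moreover have "\<forall>e\<in>set (walk_edges vs'). x \<notin> e"
    using walk_edges_subset[of _ vs'] d vs by auto
  ultimately have "distinct (walk_edges (vs @ [hd vs]))"
    using d vs e distinct_walk_edges[of vs'] by auto
  moreover have "card e = 2" if dd: "e \<in> set (walk_edges (vs @ [hd vs]))" for e
  proof -
    have "e \<in> set (walk_edges vs') \<Longrightarrow> card e = 2"
      using card_walk_edges[of vs' e] d vs by simp
    then show ?thesis
      using dd e d vs vs' \<open>last vs' \<in> set vs'\<close> by (auto simp: card_insert_if)
  qed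
  ultimately show ?thesis using vs by (auto simp: closed_trail_def)
qed

lemma cycle_degree:
  assumes "cycle_list vs" "v \<in> set vs"
  shows "degree (cycle_edges vs) v \<ge> 2"
  unfolding cycle_edges_def
  by (rule closed_trail_degree[OF cycle_list_closed_trail]) (use assms in auto)

lemma decomposable_cycle:
  assumes "cycle_list vs"
  shows "decomposable (cycle_edges vs) 1"
proof (rule decomposable_single_block)
  have ne: "vs \<noteq> []" using assms by (auto simp: cycle_list_def)
  then show "cycle_edges vs \<noteq> {}" by (rule cycle_edges_nonempty)
  have "cycle_edges vs = {{vs ! i, vs ! (Suc i mod length vs)} | i. i < length vs}"
  proof -
    \<comment> \<open>For the last index the appended head stands for the wrap-around to position
      0.\<close>
    have *: "(vs @ [hd vs]) ! Suc i = vs ! (Suc i mod length vs)"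
      "(vs @ [hd vs]) ! i = vs ! i" if "i < length vs" for i
      using that ne by (cases "Suc i = length vs"; simp add: nth_append hd_conv_nth)+
    have "{(vs @ [hd vs]) ! i, (vs @ [hd vs]) ! Suc i} = {vs ! i, vs ! (Suc i mod length vs)}"
      if "i < length vs" for i
      using *[OF that] by simp
    then show ?thesis
      unfolding cycle_edges_def set_walk_edges by (intro Collect_cong ex_cong1) auto
  qed
  moreover have "\<Union> (cycle_edges vs) = set vs"
    unfolding cycle_edges_def using ne by (subst Union_walk_edges) (auto simp: Suc_le_eq)
  ultimately have "is_cycle (\<Union> (cycle_edges vs)) (cycle_edges vs)"
    using assms unfolding is_cycle_def cycle_list_def by (intro exI[of _ vs]) simp
  then show "is_cycle (\<Union> (cycle_edges vs)) (cycle_edges vs) \<or>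
      is_single_edge (\<Union> (cycle_edges vs)) (cycle_edges vs)" ..
qed

text \<open>
  Splitting a closed trail at a repeated vertex creates one more closed trail and turns at least
  one vertex of degree 4 into a vertex of degree 2 on both parts.
\<close>

lemma decomposable_closed_trail:
  assumes "closed_trail w" "\<And>v. degree (set (walk_edges w)) v \<le> 4"
  shows "decomposable (set (walk_edges w)) (Suc (card {v. degree (set (walk_edges w)) v = 4}))"
  using assms
proof (induction "length w" arbitrary: w rule: less_induct)
  case less
  obtain x vs where w: "w = x # vs @ [x]"
    using closed_trail_obtain[OF less.prems(1)] .
  show ?case
  proof (cases "distinct (x # vs)")
    case True
    \<comment> \<open>Otherwise the trail is a loop or runs through the same edge twice.\<close>
    have "length (x # vs) \<ge> 3"
    proof (rule ccontr)
      assume "\<not> 3 \<le> length (x # vs)"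
      then consider "vs = []" | y where "vs = [y]" by (cases vs; cases "tl vs") auto
      then show False using less.prems(1) w
        by cases (auto simp: closed_trail_def insert_commute)
    qed
    then have "decomposable (cycle_edges (x # vs)) 1"
      using True by (intro decomposable_cycle) (auto simp: cycle_list_def)
    then show ?thesis
      using w by (auto simp: cycle_edges_Cons intro: decomposable_mono)
  next
    case False
    then obtain p y m s where pyms: "x # vs = p @ [y] @ m @ [y] @ s"
      using not_distinct_decomp by blast
    \<comment> \<open>\<open>w1\<close> is the stretch of the trail between two visits to
      \<open>y\<close>; \<open>w2\<close> is the trail with this detour cut out.\<close>
    define w1 where "w1 = y # m @ [y]"
    define w2 where "w2 = p @ y # s @ [x]"
    have w': "w = p @ y # m @ y # s @ [x]" using w pyms by simp
    have e: "walk_edges w = walk_edges (p @ [y]) @ walk_edges w1 @ walk_edges (y # s @ [x])"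
      unfolding w' w1_def using walk_edges_append[of p y "m @ y # s @ [x]"]
        walk_edges_append[of "y # m" y "s @ [x]"] by simp
    have e2: "walk_edges w2 = walk_edges (p @ [y]) @ walk_edges (y # s @ [x])"
      unfolding w2_def by (rule walk_edges_append)
    have hd2: "hd w2 = x" using pyms by (cases p) (auto simp: w2_def)
    have ct1: "closed_trail w1"
      using less.prems(1) e by (auto simp: closed_trail_def w1_def)
    have ct2: "closed_trail w2"
      using less.prems(1) e e2 hd2 by (auto simp: closed_trail_def w2_def)
    define X X1 X2 where "X = set (walk_edges w)" and "X1 = set (walk_edges w1)"
      and "X2 = set (walk_edges w2)"
    have XX: "X = X1 \<union> X2" "X1 \<inter> X2 = {}"
      using less.prems(1) e e2 by (auto simp: X_def X1_def X2_def closed_trail_def)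
    have fin: "finite X1" "finite X2" by (auto simp: X1_def X2_def)
    have deg: "degree X v = degree X1 v + degree X2 v" for v
      unfolding XX(1) by (rule degree_Un_disjoint[OF fin XX(2)])
    have le4: "degree X v \<le> 4" for v using less.prems(2) by (simp add: X_def)
    have d1: "decomposable X1 (Suc (card {v. degree X1 v = 4}))"
      unfolding X1_def
      by (rule less.hyps) (use ct1 w' le4 deg in \<open>auto simp: w1_def X1_def intro: le_trans[OF le_add1]\<close>)
    have d2: "decomposable X2 (Suc (card {v. degree X2 v = 4}))"
      unfolding X2_def
      by (rule less.hyps) (use ct2 w' le4 deg in \<open>auto simp: w2_def X2_def intro: le_trans[OF le_add2]\<close>)
    have "degree X1 y \<ge> 2" "degree X2 y \<ge> 2"
      using closed_trail_degree[OF ct1, of y] closed_trail_degree[OF ct2, of y]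
      by (auto simp: X1_def X2_def w1_def w2_def)
    then have y: "degree X1 y = 2" "degree X2 y = 2" using deg[of y] le4[of y] by linarith+
    have finX: "finite {v. degree X v = 4}"
    proof (rule finite_subset)
      show "{v. degree X v = 4} \<subseteq> set w"
      proof
        fix v assume "v \<in> {v. degree X v = 4}"
        then have "{e \<in> X. v \<in> e} \<noteq> {}" by (intro notI) (simp add: degree_def)
        then show "v \<in> set w" using walk_edges_subset[of _ w] unfolding X_def by blast
      qed
    qed simp
    \<comment> \<open>Degrees of the parts add up to at most 4. So a vertex of degree 4 in one part
      has degree 0 in the other, and \<open>y\<close>, of degree 2 in both, is a new vertex of
      degree 4.\<close>
    have sub: "insert y ({v. degree X1 v = 4} \<union> {v. degree X2 v = 4}) \<subseteq> {v. degree X v = 4}"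
    proof -
      have "degree X v = 4" if "degree X1 v = 4 \<or> degree X2 v = 4" for v
        using that deg[of v] le4[of v] by linarith
      then show ?thesis using y deg by auto
    qed
    have disj: "{v. degree X1 v = 4} \<inter> {v. degree X2 v = 4} = {}"
    proof -
      have "\<not> (degree X1 v = 4 \<and> degree X2 v = 4)" for v
        using deg[of v] le4[of v] by linarith
      then show ?thesis by blast
    qed
    have "card (insert y ({v. degree X1 v = 4} \<union> {v. degree X2 v = 4}))
        = Suc (card {v. degree X1 v = 4} + card {v. degree X2 v = 4})"
      using y disj finite_subset[OF sub finX] by (subst card_insert_disjoint) (auto simp: card_Un_disjoint)
    then have "Suc (card {v. degree X1 v = 4}) + Suc (card {v. degree X2 v = 4})
        \<le> Suc (card {v. degree X v = 4})"
      using card_mono[OF finX sub] by linarith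
    then have "decomposable X (Suc (card {v. degree X v = 4}))"
      using decomposable_Un[OF d1 d2 XX(2)] XX(1) decomposable_mono by metis
    then show ?thesis by (simp add: X_def)
  qed
qed

text \<open>Shows that a path whose vertices before \<open>t\<close> avoid a trail shares no edge
  with it.\<close>

lemma walk_edges_meets: "e \<in> set (walk_edges (q @ [t])) \<Longrightarrow> e \<inter> set q \<noteq> {}"
proof (induction q)
  case (Cons a q)
  then show ?case by (cases q) auto
qed simp

text \<open>
  The case of Menger's theorem for two edge-disjoint paths. The set of vertices that share a closed
  trail with \<open>u\<close> can be left only through a bridge.
\<close>

lemma closed_trail_through:
  assumes card2: "\<And>e. e \<in> H \<Longrightarrow> card e = 2" and uv: "conn H u v" "u \<noteq> v"
    and nosep: "\<And>b. b \<in> H \<Longrightarrow> conn (H - {b}) u v"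
  obtains w where "closed_trail w" "set (walk_edges w) \<subseteq> H" "u \<in> set w" "v \<in> set w"
proof -
  \<comment> \<open>Unlike \<open>closed_trail\<close>, this fixes the base \<open>u\<close> and
    admits the trivial walk, which puts \<open>u\<close> into \<open>U\<close>.\<close>
  define ct where "ct w \<longleftrightarrow> w \<noteq> [] \<and> hd w = u \<and> last w = u \<and> distinct (walk_edges w)
    \<and> set (walk_edges w) \<subseteq> H" for w
  define U where "U = {x. \<exists>w. ct w \<and> x \<in> set w}"
  have "ct [u]" by (auto simp: ct_def)
  then have uU: "u \<in> U" by (auto simp: U_def intro!: exI[of _ "[u]"])
  have "v \<in> U"
  proof (rule ccontr)
    assume vU: "v \<notin> U"
    obtain p where p: "p \<noteq> []" "hd p = u" "last p = v" "distinct p" "set (walk_edges p) \<subseteq> H"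
      using conn_obtain_path[OF uv(1)] .
    have "\<exists>x\<in>set p. x \<in> U" using p(1,2) uU by (metis hd_in_set)
    \<comment> \<open>With \<open>x\<close> the last vertex of the path in \<open>U\<close>, the
      next edge \<open>e\<close> leaves \<open>U\<close> and the rest of the path never
      returns.\<close>
    then obtain ys x zs where split: "p = ys @ x # zs" "x \<in> U" "\<forall>z\<in>set zs. z \<notin> U"
      using split_list_last_prop[of p "\<lambda>x. x \<in> U"] by blast
    have "zs \<noteq> []" using split p(3) vU by auto
    then obtain x' zs' where zs: "zs = x' # zs'" by (cases zs) auto
    define e where "e = {x, x'}"
    have we: "walk_edges p = walk_edges (ys @ [x]) @ e # walk_edges zs"
      using split(1) zs walk_edges_append[of ys x zs] by (simp add: e_def)
    then have eH: "e \<in> H" using p(5) by auto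
    have x': "x' \<notin> U" using split(3) zs by auto
    have "e \<notin> set (walk_edges zs)"
      using walk_edges_subset[of e zs] split(2,3) by (auto simp: e_def)
    then have "set (walk_edges zs) \<subseteq> H - {e}" using p(5) we by auto
    moreover have "v \<in> set zs" using p(3) split(1) zs
      by (metis last_appendR last_ConsR last_in_set list.distinct(1))
    ultimately have c1: "conn (H - {e}) x' v" using zs by (intro conn_walk[of zs]) auto
    obtain w where w: "ct w" "x \<in> set w" using split(2) by (auto simp: U_def)
    have wU: "set w \<subseteq> U" using w(1) by (auto simp: U_def)
    then have "e \<notin> set (walk_edges w)" using walk_edges_subset[of e w] x' by (auto simp: e_def)
    then have "set (walk_edges w) \<subseteq> H - {e}" using w(1) by (auto simp: ct_def)
    then have c2: "conn (H - {e}) u x"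
      using w by (intro conn_walk[of w]) (auto simp: ct_def)
    \<comment> \<open>Since \<open>e\<close> does not separate \<open>u\<close> from
      \<open>v\<close>, there is a way back from \<open>x'\<close> that avoids \<open>e\<close>. Cut
      at its first vertex \<open>t\<close> on \<open>w\<close>, it forms together with
      \<open>e\<close> an ear of \<open>w\<close>.\<close>
    have "conn (H - {e}) x' x"
      using c1 c2 nosep[OF eH] conn_sym conn_trans by metis
    then obtain q t where q: "q = [] \<or> hd q = x'" "q = [] \<Longrightarrow> t = x'" "t \<in> set w" "set q \<inter> set w = {}"
      "distinct (q @ [t])" "set (walk_edges (q @ [t])) \<subseteq> H - {e}"
      using conn_obtain_path_until[OF _ w(2)] by metis
    have "x' \<notin> set w" using wU x' by auto
    then have qne: "q \<noteq> []" and hdq: "hd q = x'" using q(1-3) by auto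
    have ear: "walk_edges (x # q @ [t]) = e # walk_edges (q @ [t])"
      using qne hdq by (simp add: walk_edges_Cons e_def)
    have ear_dist: "distinct (walk_edges (x # q @ [t]))"
      using ear q(6) distinct_walk_edges[OF q(5)] by auto
    have ear_disj: "set (walk_edges (x # q @ [t])) \<inter> set (walk_edges w) = {}"
    proof -
      have "f \<notin> set (walk_edges w)" if "f \<in> set (walk_edges (q @ [t]))" for f
        using walk_edges_meets[OF that] q(4) walk_edges_subset[of f w] by blast
      then show ?thesis using ear \<open>e \<notin> set (walk_edges w)\<close> by auto
    qed
    have ear_H: "set (walk_edges (x # q @ [t])) \<subseteq> H" using ear eH q(6) by auto
    obtain a b where ab: "w = a @ x # b" using w(2) by (meson split_list)
    have wab: "walk_edges w = walk_edges (a @ [x]) @ walk_edges (x # b)"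
      using ab walk_edges_append by metis
    \<comment> \<open>The ear replaces the stretch of \<open>w\<close> between \<open>x\<close> and
      \<open>t\<close>, run backwards if \<open>t\<close> occurs before \<open>x\<close>. The new
      trail visits \<open>x'\<close>.\<close>
    have "\<exists>w'. ct w' \<and> x' \<in> set w'"
    proof (cases "t \<in> set a")
      case True
      then obtain c d where cd: "a = c @ t # d" by (meson split_list)
      define w' where "w' = c @ t # rev q @ x # b"
      have wc: "walk_edges (a @ [x]) = walk_edges (c @ [t]) @ walk_edges (t # d @ [x])"
        using cd walk_edges_append[of c t "d @ [x]"] by simp
      have "walk_edges w' = walk_edges (c @ [t]) @ walk_edges (t # rev q @ [x]) @ walk_edges (x # b)"
        unfolding w'_def using walk_edges_append[of c t "rev q @ x # b"]
          walk_edges_append[of "t # rev q" x b] by simp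
      moreover have "walk_edges (t # rev q @ [x]) = rev (walk_edges (x # q @ [t]))"
        using walk_edges_rev[of "x # q @ [t]"] by simp
      ultimately have "distinct (walk_edges w')" "set (walk_edges w') \<subseteq> H"
        using w(1) wab wc ear_dist ear_disj ear_H unfolding ct_def by auto
      moreover have "hd w' = u" "last w' = u"
        using w(1) ab cd unfolding ct_def w'_def by (cases c; auto)+
      ultimately have "ct w'" unfolding ct_def w'_def by auto
      then show ?thesis using qne hdq by (intro exI[of _ w']) (auto simp: w'_def)
    next
      case False
      then have "t \<in> set (x # b)" using q(3) ab by auto
      then obtain c d where cd: "x # b = c @ t # d" by (meson split_list)
      define w' where "w' = a @ x # q @ t # d"
      have wc: "walk_edges (x # b) = walk_edges (c @ [t]) @ walk_edges (t # d)"
        using cd walk_edges_append by metis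
      have "walk_edges w' = walk_edges (a @ [x]) @ walk_edges (x # q @ [t]) @ walk_edges (t # d)"
        unfolding w'_def using walk_edges_append[of a x "q @ t # d"]
          walk_edges_append[of "x # q" t d] by simp
      then have "distinct (walk_edges w')" "set (walk_edges w') \<subseteq> H"
        using w(1) wab wc ear_dist ear_disj ear_H unfolding ct_def by auto
      moreover have "hd w' = u" using w(1) ab unfolding ct_def w'_def by (cases a) auto
      moreover have "last w' = u"
      proof -
        have "last w = last (x # b)" using ab by simp
        also have "\<dots> = last (t # d)" using cd by simp
        finally show ?thesis using w(1) unfolding ct_def w'_def by simp
      qed
      ultimately have "ct w'" unfolding ct_def w'_def by auto
      then show ?thesis using qne hdq by (intro exI[of _ w']) (auto simp: w'_def)
    qed
    then show False using x' by (auto simp: U_def)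
  qed
  then obtain w where w: "ct w" "v \<in> set w" by (auto simp: U_def)
  have "length w \<ge> 2"
    using w uv(2) by (cases w; cases "tl w") (auto simp: ct_def)
  then have "closed_trail w" using w(1) card2 by (auto simp: ct_def closed_trail_def)
  moreover have "u \<in> set w" using w(1) by (auto simp: ct_def)
  ultimately show ?thesis using that w by (auto simp: ct_def)
qed

lemma cycle_rotate_to:
  assumes "cycle_list C" "x \<in> set C"
  obtains a where "cycle_list (x # a)" "cycle_edges (x # a) = cycle_edges C" "set (x # a) = set C"
proof -
  obtain p q where "C = p @ x # q" using assms(2) by (meson split_list)
  then show ?thesis
    using that[of "q @ p"] assms(1) cycle_edges_rotate[of p "x # q"]
    by (auto simp: cycle_list_def)
qed

lemma finite_cycle_edges [simp]: "finite (cycle_edges C)"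
  by (simp add: cycle_edges_def)

lemma cycle_degree_le:
  assumes "cycle_list C" "x \<in> set C"
  shows "degree (cycle_edges C) x \<le> 2"
proof -
  obtain a where a: "cycle_list (x # a)" "cycle_edges (x # a) = cycle_edges C"
    using cycle_rotate_to[OF assms] by metis
  then have ne: "a \<noteq> []" by (auto simp: cycle_list_def)
  have "cycle_edges C = insert {x, hd a} (insert {last a, x} (set (walk_edges a)))"
    using ne a(2) by (auto simp: cycle_edges_Cons walk_edges_Cons walk_edges_snoc)
  moreover have "x \<notin> e" if "e \<in> set (walk_edges a)" for e
    using walk_edges_subset[OF that] a(1) by (auto simp: cycle_list_def)
  ultimately have "{e \<in> cycle_edges C. x \<in> e} \<subseteq> {{x, hd a}, {last a, x}}" by auto
  then have "card {e \<in> cycle_edges C. x \<in> e} \<le> card {{x, hd a}, {last a, x}}"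
    by (intro card_mono) auto
  also have "\<dots> \<le> 2" by (simp add: card_insert_if)
  finally show ?thesis by (simp add: degree_def)
qed

lemma cycle_conn: "x \<in> set C \<Longrightarrow> y \<in> set C \<Longrightarrow> cycle_edges C \<subseteq> E \<Longrightarrow> conn E x y"
  unfolding cycle_edges_def by (rule conn_walk[of "C @ [hd C]"]) auto

lemma card_cycle: "cycle_list C \<Longrightarrow> card (set C) \<ge> 3"
  by (auto simp: cycle_list_def distinct_card)

subsection \<open>Minimal counterexamples\<close>

text \<open>
  The largest separated subset of \<open>V\<close> has one vertex in each component, so a bound by
  \<open>card V - card S\<close> for all separated \<open>S\<close> amounts to \<open>n\<close> minus the number of components.
\<close>

definition separated :: "'a set set \<Rightarrow> 'a set \<Rightarrow> bool" where
  "separated E S \<longleftrightarrow> (\<forall>x\<in>S. \<forall>y\<in>S. conn E x y \<longrightarrow> x = y)"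

text \<open>\<open>smaller\<close> is the induction hypothesis. \<open>V\<close> stays fixed while
  edges are removed, and the degree bound passes to subsets of \<open>E\<close>.\<close>

locale minimal_counterexample =
  fixes V :: "'a set" and E :: "'a set set" and S :: "'a set"
  assumes finV: "finite V"
    and edge: "e \<in> E \<Longrightarrow> e \<subseteq> V \<and> card e = 2"
    and deg4: "degree E v \<le> 4"
    and SV: "S \<subseteq> V" and sepS: "separated E S"
    and smaller: "E' \<subset> E \<Longrightarrow> S' \<subseteq> V \<Longrightarrow> separated E' S' \<Longrightarrow> decomposable E' (card V - card S')"
    and not_decomposable: "\<not> decomposable E (card V - card S)"
begin

lemma finE: "finite E"
  using edge finV by (meson PowI finite_Pow_iff rev_finite_subset subsetI)

lemma edge_neq: "{x, y} \<in> E \<Longrightarrow> x \<noteq> y"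
  using edge[of "{x, y}"] by auto

lemma edge_other:
  assumes "e \<in> E" "x \<in> e"
  obtains z where "e = {x, z}" "z \<noteq> x"
  using edge[OF assms(1)] assms(2) that by (auto simp: card_2_iff)

lemma edge_V: "{x, y} \<in> E \<Longrightarrow> x \<in> V"
  using edge[of "{x, y}"] by auto

lemma conn_V: "conn E x y \<Longrightarrow> x \<in> V \<Longrightarrow> y \<in> V"
  by (erule conn_closed) (use edge in auto)

lemma degree_Diff: "X \<subseteq> F \<Longrightarrow> F \<subseteq> E \<Longrightarrow> degree F v = degree X v + degree (F - X) v"
  using degree_Un_disjoint[of X "F - X" v] finE finite_subset
  by (metis Diff_disjoint Un_Diff_cancel Un_absorb1 finite_Diff)

text \<open>\<open>T\<close> witnesses that removing \<open>k\<close> pieces splits one component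
  \<open>Z\<close> into more than \<open>k\<close> parts. At most one vertex of \<open>S\<close>
  lies in \<open>Z\<close>; exchanging it for \<open>T\<close> enlarges the separated set by at
  least \<open>k\<close>, which pays for the removed pieces.\<close>

lemma no_gain:
  assumes E': "E' \<subset> E" and dec: "decomposable (E - E') k"
    and T: "T \<subseteq> V" "\<And>x y. x \<in> T \<Longrightarrow> y \<in> T \<Longrightarrow> conn E x y" "separated E' T" "Suc k \<le> card T"
  shows False
proof -
  define Z where "Z = {s. \<exists>t\<in>T. conn E s t}"
  define S' where "S' = (S - Z) \<union> T"
  have fin: "finite S" "finite T" using SV T(1) finV finite_subset by auto
  have conn_Z: "conn E x y" if xy: "x \<in> Z" "y \<in> Z" for x y
  proof -
    obtain s t where "s \<in> T" "conn E x s" "t \<in> T" "conn E y t"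
      using xy unfolding Z_def by blast
    then show ?thesis using T(2) conn_sym conn_trans by meson
  qed
  have "x = y" if "x \<in> S \<inter> Z" "y \<in> S \<inter> Z" for x y
    using that conn_Z[of x y] sepS unfolding separated_def by blast
  then have "card (S \<inter> Z) \<le> 1"
    by (metis One_nat_def card_le_Suc0_iff_eq finite_Int fin(1))
  moreover have "card S = card (S \<inter> Z) + card (S - Z)"
    using fin(1) by (rule card_Int_Diff)
  moreover have TZ: "T \<subseteq> Z"
  proof
    fix x assume "x \<in> T"
    then show "x \<in> Z" unfolding Z_def mem_Collect_eq by (rule bexI[rotated]) simp
  qed
  then have "card S' = card (S - Z) + card T"
    unfolding S'_def using fin by (intro card_Un_disjoint) auto
  ultimately have card: "card S + k \<le> card S'" using T(4) by linarith
  have S'V: "S' \<subseteq> V" using SV T(1) by (auto simp: S'_def)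
  have "separated E' S'"
    unfolding separated_def
  proof (intro ballI impI)
    fix x y assume xy: "x \<in> S'" "y \<in> S'" "conn E' x y"
    have c: "conn E x y" using conn_mono[OF xy(3)] E' by auto
    \<comment> \<open>\<open>Z\<close> is closed under connection in \<open>E\<close>, so
      \<open>x\<close> and \<open>y\<close> both come from \<open>T\<close> or both from
      \<open>S\<close>.\<close>
    have "conn E x t \<longleftrightarrow> conn E y t" for t
      using conn_trans[OF c] conn_trans[OF conn_sym[OF c]] by auto
    then have "x \<in> Z \<longleftrightarrow> y \<in> Z" by (simp add: Z_def)
    then consider "x \<in> T" "y \<in> T" | "x \<in> S" "y \<in> S"
      using xy(1,2) TZ unfolding S'_def by blast
    then show "x = y"
      by cases (use T(3) sepS xy(3) c in \<open>auto simp: separated_def\<close>)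
  qed
  then have "decomposable ((E - E') \<union> E') (k + (card V - card S'))"
    by (intro decomposable_Un dec smaller[OF E' S'V]) auto
  moreover have "(E - E') \<union> E' = E" using E' by auto
  \<comment> \<open>Guards against truncated subtraction.\<close>
  moreover have "card S' \<le> card V" using S'V finV by (simp add: card_mono)
  then have "k + (card V - card S') \<le> card V - card S" using card by linarith
  ultimately show False using not_decomposable decomposable_mono by metis
qed

text \<open>The case \<open>k = 1\<close> with \<open>T = {x, y}\<close>: removing a cycle
  disconnects nothing.\<close>

lemma no_gain_cycle:
  assumes "cycle_list C" "cycle_edges C \<subseteq> E" "conn E x y" "x \<in> V" "\<not> conn (E - cycle_edges C) x y"
  shows False
proof (rule no_gain)
  show "E - cycle_edges C \<subset> E"
  proof -
    have "cycle_edges C \<noteq> {}"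
      using assms(1) by (intro cycle_edges_nonempty) (auto simp: cycle_list_def)
    then show ?thesis using assms(2) by blast
  qed
  show "decomposable (E - (E - cycle_edges C)) 1"
    using decomposable_cycle[OF assms(1)] assms(2) by (simp add: double_diff)
  show "{x, y} \<subseteq> V" using assms(3,4) conn_V by auto
  show "separated (E - cycle_edges C) {x, y}"
    using assms(5) conn_sym[of _ y x] by (auto simp: separated_def)
  have "x \<noteq> y" using assms(5) by auto
  then show "Suc 1 \<le> card {x, y}" by simp
qed (use assms(3) conn_sym in auto)

text \<open>A bridge, taken as a single piece, would pay for itself by the extra component.\<close>

lemma no_bridge:
  assumes "{x, y} \<in> E"
  shows "conn (E - {{x, y}}) x y"
proof (rule ccontr)
  assume n: "\<not> ?thesis"
  have ne: "x \<noteq> y" using assms by (rule edge_neq)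
  show False
  proof (rule no_gain)
    show "E - {{x, y}} \<subset> E" using assms by auto
    show "decomposable (E - (E - {{x, y}})) 1"
      using decomposable_edge[OF ne] assms by (simp add: double_diff)
    show "{x, y} \<subseteq> V" using edge[OF assms] by auto
    show "separated (E - {{x, y}}) {x, y}"
      using n conn_sym[of _ y x] by (auto simp: separated_def)
    show "Suc 1 \<le> card {x, y}" using ne by simp
  qed (use assms conn_edge conn_sym in \<open>metis conn_refl insert_iff singletonD\<close>)
qed

lemma cycle_through_edge:
  assumes xz: "{x, z} \<in> E"
  obtains q where "cycle_list (x # z # q)" "cycle_edges (x # z # q) \<subseteq> E"
proof -
  obtain p where p: "p \<noteq> []" "hd p = z" "last p = x" "distinct p"
    "set (walk_edges p) \<subseteq> E - {{x, z}}"
    using conn_obtain_path[OF conn_sym[OF no_bridge[OF xz]]] .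
  have ne: "x \<noteq> z" using edge_neq[OF xz] .
  then obtain q where q: "p = z # q @ [x]"
    using p(1-3) by (metis append_butlast_last_id last_ConsL last_ConsR list.collapse)
  have "q \<noteq> []" using p(5) q by (auto simp: insert_commute)
  then have "cycle_list (x # z # q)"
    using p(4) q by (cases q) (auto simp: cycle_list_def)
  moreover have "cycle_edges (x # z # q) \<subseteq> E"
    using p(5) q xz by (auto simp: cycle_edges_Cons)
  ultimately show ?thesis using that by blast
qed

text \<open>At a vertex of degree at most 2, removing a cycle through the given edge would isolate
  the vertex.\<close>

lemma degree_ge_3:
  assumes "{x, z} \<in> E"
  shows "degree E x \<ge> 3"
proof (rule ccontr)
  assume "\<not> ?thesis"
  obtain q where q: "cycle_list (x # z # q)" "cycle_edges (x # z # q) \<subseteq> E"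
    using cycle_through_edge[OF assms] .
  let ?C = "x # z # q"
  have "degree (E - cycle_edges ?C) x = 0"
    using degree_Diff[OF q(2), of x] cycle_degree[OF q(1), of x] \<open>\<not> degree E x \<ge> 3\<close> by simp
  then have "\<not> conn (E - cycle_edges ?C) x z"
    using degree_0_conn[of "E - cycle_edges ?C" x z] finE edge_neq[OF assms] by auto
  then show False
    using no_gain_cycle[OF q] conn_edge[OF assms] edge_V[OF assms] by blast
qed

lemma off_cycle_edge:
  assumes "cycle_list C" "cycle_edges C \<subseteq> E" "x \<in> set C"
  obtains z where "{x, z} \<in> E" "{x, z} \<notin> cycle_edges C"
proof -
  have "degree (cycle_edges C) x > 0" using cycle_degree[OF assms(1,3)] by simp
  then obtain e where "e \<in> cycle_edges C" "x \<in> e"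
    unfolding degree_def by (metis (no_types, lifting) card_gt_0_iff empty_Collect_eq)
  then have "degree E x \<ge> 3"
    using assms(2) edge_other degree_ge_3 by (metis subsetD)
  then have "degree (E - cycle_edges C) x > 0"
    using degree_Diff[OF assms(2), of x] cycle_degree_le[OF assms(1,3)] by simp
  then obtain f where "f \<in> E - cycle_edges C" "x \<in> f"
    unfolding degree_def by (metis (no_types, lifting) card_gt_0_iff empty_Collect_eq)
  then show ?thesis using that edge_other by (metis DiffD1 DiffD2)
qed

section \<open>Pairs of a cycle and a connected set off the cycle\<close>

definition admissible :: "'a list \<Rightarrow> 'a set \<Rightarrow> bool" where
  "admissible C R \<longleftrightarrow> cycle_list C \<and> cycle_edges C \<subseteq> E \<and> R \<noteq> {} \<and> R \<subseteq> V \<and> R \<inter> set C = {}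
     \<and> (\<forall>a\<in>R. \<forall>b\<in>R. conn {e \<in> E. e \<subseteq> R} a b) \<and> (\<exists>r\<in>R. \<exists>c\<in>set C. conn E r c)"

lemma cycle_V: "cycle_list C \<Longrightarrow> cycle_edges C \<subseteq> E \<Longrightarrow> x \<in> set C \<Longrightarrow> x \<in> V"
  using off_cycle_edge edge_V by metis

text \<open>A shortest cycle has no chord, so an edge leaving it at \<open>x\<close> ends at some
  \<open>z\<close> outside, and the set can be \<open>{z}\<close>.\<close>

lemma ex_admissible: "\<exists>C R. admissible C R"
proof -
  have "E \<noteq> {}" using not_decomposable decomposable_empty decomposable_mono by blast
  then obtain e where e: "e \<in> E" by blast
  then obtain x z where "e = {x, z}" using edge by (metis card_2_iff)
  then obtain q where "cycle_list (x # z # q)" "cycle_edges (x # z # q) \<subseteq> E"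
    using cycle_through_edge e by metis
  then obtain C where C: "cycle_list C" "cycle_edges C \<subseteq> E"
    and shortest: "\<And>D. cycle_list D \<Longrightarrow> cycle_edges D \<subseteq> E \<Longrightarrow> length C \<le> length D"
    using ex_has_least_nat[of "\<lambda>C. cycle_list C \<and> cycle_edges C \<subseteq> E" _ length] by blast
  have "hd C \<in> set C" using C(1) by (cases C) (auto simp: cycle_list_def)
  then obtain a where a: "cycle_list (hd C # a)" "cycle_edges (hd C # a) = cycle_edges C"
    "set (hd C # a) = set C"
    using cycle_rotate_to[OF C(1)] by blast
  define x where "x = hd C"
  obtain z where z: "{x, z} \<in> E" "{x, z} \<notin> cycle_edges C"
    using off_cycle_edge[OF C \<open>hd C \<in> set C\<close>] unfolding x_def .
  have len: "length (x # a) = length C"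
    using a(1,3) C(1) unfolding x_def cycle_list_def by (metis distinct_card)
  have "z \<notin> set C"
  proof
    assume "z \<in> set C"
    then have "z \<in> set (x # a)" unfolding x_def a(3) .
    then have "z \<in> set a" using edge_neq[OF z(1)] by simp
    then obtain b c where bc: "a = b @ z # c" by (meson split_list)
    have ce: "cycle_edges C = set (walk_edges (x # b @ [z])) \<union> set (walk_edges (z # c @ [x]))"
      using a(2) bc cycle_edges_split[of x b z c] by (simp add: x_def)
    \<comment> \<open>A chord is not an edge of the cycle, so neither arc is a single edge. Hence
      the chord closes one arc to a cycle, and the nonempty other arc makes it shorter.\<close>
    have "b = [] \<Longrightarrow> {x, z} \<in> cycle_edges C" using ce by simp
    with z(2) have "b \<noteq> []" by blast
    have "c = [] \<Longrightarrow> {x, z} \<in> cycle_edges C" using ce by (simp add: insert_commute)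
    with z(2) have "c \<noteq> []" by blast
    have "cycle_list (x # b @ [z])"
      using a(1) bc \<open>b \<noteq> []\<close> by (cases b) (auto simp: cycle_list_def x_def)
    moreover have "cycle_edges (x # b @ [z]) \<subseteq> E"
      using cycle_edges_split[of x b z "[]"] ce C(2) z(1) by (auto simp: insert_commute)
    ultimately show False using shortest[of "x # b @ [z]"] len bc \<open>c \<noteq> []\<close> by (cases c) auto
  qed
  then have "admissible C {z}"
    using C z(1) edge_V[of z x] conn_edge[of z x E] \<open>hd C \<in> set C\<close>
    unfolding admissible_def x_def by (auto simp: insert_commute)
  then show ?thesis by blast
qed

end

section \<open>A pair whose connected set is as large as possible\<close>

locale maximal_pair = minimal_counterexample V E S
  for V :: "'a set" and E S +
  fixes C :: "'a list" and R :: "'a set"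
  assumes adm: "admissible C R"
    and maximal: "admissible D Q \<Longrightarrow> card Q \<le> card R"
begin

lemma C: "cycle_list C" "cycle_edges C \<subseteq> E"
  and R: "R \<noteq> {}" "R \<subseteq> V" "R \<inter> set C = {}"
    "\<And>a b. a \<in> R \<Longrightarrow> b \<in> R \<Longrightarrow> conn {e \<in> E. e \<subseteq> R} a b"
  using adm by (auto simp: admissible_def)

lemma conn_RC: "r \<in> R \<Longrightarrow> c \<in> set C \<Longrightarrow> conn E r c"
proof -
  assume rc: "r \<in> R" "c \<in> set C"
  obtain r' c' where r'c': "r' \<in> R" "c' \<in> set C" "conn E r' c'"
    using adm by (auto simp: admissible_def)
  have "conn E r r'" using R(4)[OF rc(1) r'c'(1)] by (rule conn_mono) auto
  moreover have "conn E c' c" using cycle_conn[OF r'c'(2) rc(2) C(2)] .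
  ultimately show ?thesis using r'c'(3) conn_trans by metis
qed

definition nbrs :: "'a set" where
  "nbrs = {c. c \<notin> R \<and> (\<exists>r\<in>R. {r, c} \<in> E)}"

text \<open>A vertex \<open>c\<close> of \<open>nbrs\<close> off \<open>D\<close> could be added to
  \<open>R\<close>, against maximality, which ranges over all cycles. The common vertex
  \<open>x\<close> keeps \<open>D\<close> in the component of \<open>R\<close>.\<close>

lemma nbrs_subset:
  assumes D: "cycle_list D" "cycle_edges D \<subseteq> E" "R \<inter> set D = {}" and x: "x \<in> set C" "x \<in> set D"
  shows "nbrs \<subseteq> set D"
proof
  fix c assume "c \<in> nbrs"
  then obtain r where r: "r \<in> R" "{r, c} \<in> E" "c \<notin> R" by (auto simp: nbrs_def)
  show "c \<in> set D"
  proof (rule ccontr)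
    assume cD: "c \<notin> set D"
    have *: "conn {e \<in> E. e \<subseteq> insert c R} r a" if "a \<in> insert c R" for a
    proof (cases "a = c")
      case True
      then show ?thesis using r by (auto intro: conn_edge)
    next
      case False
      then have "conn {e \<in> E. e \<subseteq> R} r a" using R(4) r(1) that by auto
      then show ?thesis by (rule conn_mono) auto
    qed
    have "conn {e \<in> E. e \<subseteq> insert c R} a b" if "a \<in> insert c R" "b \<in> insert c R" for a b
      using conn_common[OF *[OF that(1)] *[OF that(2)]] .
    moreover have "conn E r x" using conn_RC r(1) x(1) by simp
    moreover have "c \<in> V" using r(2) edge by auto
    ultimately have "admissible D (insert c R)"
      using D x(2) cD r(1) R(2) unfolding admissible_def by blast
    then have "card (insert c R) \<le> card R" by (rule maximal)
    then show False using r(3) finite_subset[OF R(2) finV] by simp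
  qed
qed

lemma nbrs_C: "nbrs \<subseteq> set C"
proof -
  have "hd C \<in> set C" using C(1) by (cases C) (auto simp: cycle_list_def)
  then show ?thesis using nbrs_subset[OF C R(3)] by blast
qed

lemma nbrs_nonempty: "nbrs \<noteq> {}"
proof -
  obtain r where r: "r \<in> R" using R(1) by blast
  have c: "hd C \<in> set C" using C(1) by (cases C) (auto simp: cycle_list_def)
  then have "hd C \<notin> R" using R(3) by auto
  then obtain a b where "{a, b} \<in> E" "a \<in> R" "b \<notin> R"
    using conn_exit[OF conn_RC[OF r c] r] by blast
  then show ?thesis by (auto simp: nbrs_def)
qed

text \<open>
  Following an edge that leaves \<open>C\<close> away from \<open>R\<close> until it returns to \<open>C\<close> at \<open>y\<close> gives a path whose
  union with either arc of \<open>C\<close> between \<open>x\<close> and \<open>y\<close> is a cycle disjoint from \<open>R\<close>.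
\<close>

lemma ear:
  assumes x: "x \<in> set C" and xz: "{x, z} \<in> E" "{x, z} \<notin> cycle_edges C" and zR: "z \<notin> R"
  obtains y where "y \<in> set C" "nbrs \<subseteq> {x, y}"
    "y \<noteq> x \<Longrightarrow> \<exists>g\<in>E. y \<in> g \<and> g \<notin> cycle_edges C \<and> g \<inter> R = {}"
proof -
  have ne: "x \<noteq> z" using edge_neq[OF xz(1)] .
  have xR: "x \<notin> R" using x R(3) by auto
  obtain q y where q: "q = [] \<or> hd q = z" "q = [] \<Longrightarrow> y = z" "y \<in> set C" "set q \<inter> set C = {}"
    "distinct (q @ [y])" "set (walk_edges (q @ [y])) \<subseteq> E - {{x, z}}"
    using conn_obtain_path_until[OF conn_sym[OF no_bridge[OF xz(1)]] x] by metis
  \<comment> \<open>Just before entering \<open>R\<close> the path would visit a vertex of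
    \<open>nbrs\<close>, hence of \<open>C\<close>, which \<open>q\<close> avoids.\<close>
  have qR: "set q \<inter> R = {}"
  proof (rule ccontr)
    assume "set q \<inter> R \<noteq> {}"
    then obtain q1 r q2 where r: "q = q1 @ r # q2" "r \<in> R" "\<forall>v\<in>set q1. v \<notin> R"
      using split_list_first_prop[of q "\<lambda>v. v \<in> R"] by blast
    have "q1 \<noteq> []" using r q(1) zR by auto
    then have "{last q1, r} \<in> E"
      using q(6) r(1) walk_edges_append[of q1 r "q2 @ [y]"] by (auto simp: walk_edges_snoc)
    then have "last q1 \<in> nbrs"
      using r(2,3) \<open>q1 \<noteq> []\<close> by (auto simp: nbrs_def insert_commute)
    then have "last q1 \<in> set C" using nbrs_C by auto
    moreover have "last q1 \<in> set q" using r(1) \<open>q1 \<noteq> []\<close> by auto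
    ultimately show False using q(4) by auto
  qed
  have xq: "set (walk_edges (x # q @ [y])) \<subseteq> E"
    using q(1,2,6) xz(1) by (cases q) (auto simp: walk_edges_Cons)
  obtain a where a: "cycle_list (x # a)" "cycle_edges (x # a) = cycle_edges C" "set (x # a) = set C"
    using cycle_rotate_to[OF C(1) x] .
  have CR: "set (x # a) \<inter> R = {}" using a(3) R(3) by auto
  show ?thesis
  proof (cases "y = x")
    case True
    then have "q \<noteq> []" using q(2) ne by auto
    then have hq: "hd q = z" using q(1) by auto
    \<comment> \<open>The path may not return to \<open>x\<close> along the removed edge, so it
      closes to a cycle that meets \<open>C\<close> in \<open>x\<close> only.\<close>
    have "tl q \<noteq> []"
    proof
      assume "tl q = []"
      then have "q = [z]" using \<open>q \<noteq> []\<close> hq by (cases q) auto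
      then show False using q(6) True by (auto simp: insert_commute)
    qed
    then have "cycle_list (x # q)"
      using q(5) True \<open>q \<noteq> []\<close> by (cases q; cases "tl q") (auto simp: cycle_list_def)
    moreover have "cycle_edges (x # q) \<subseteq> E" using xq True by (simp add: cycle_edges_Cons)
    ultimately have "nbrs \<subseteq> set (x # q)"
      using nbrs_subset[of "x # q" x] qR xR x by auto
    then have "nbrs \<subseteq> {x, x}" using nbrs_C q(4) by auto
    then show ?thesis using that[of x] x by simp
  next
    case False
    then have "y \<in> set a" using q(3) a(3) by auto
    then obtain b c where bc: "a = b @ y # c" by (meson split_list)
    have ce: "cycle_edges C = set (walk_edges (x # b @ [y])) \<union> set (walk_edges (y # c @ [x]))"
      using a(2) bc cycle_edges_split[of x b y c] by simp
    \<comment> \<open>An empty \<open>q\<close> makes \<open>{x, y}\<close> a chord; then neither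
      arc is a single edge and both cycles below have at least three vertices.\<close>
    have short: "q = [] \<Longrightarrow> {x, y} \<notin> cycle_edges C" using q(2) xz(2) by auto
    have "b = [] \<Longrightarrow> {x, y} \<in> cycle_edges C" using ce by simp
    with short have bq: "b \<noteq> [] \<or> q \<noteq> []" by blast
    have "c = [] \<Longrightarrow> {x, y} \<in> cycle_edges C" using ce by (simp add: insert_commute)
    with short have cq: "c \<noteq> [] \<or> q \<noteq> []" by blast
    have dist: "distinct (x # b @ y # c)" using a(1) bc by (simp add: cycle_list_def)
    have disj: "set q \<inter> set (x # b @ y # c) = {}" using q(4) a(3) bc by auto
    let ?D1 = "x # b @ y # rev q" and ?D2 = "y # c @ x # q"
    have rq: "set (walk_edges (y # rev q @ [x])) = set (walk_edges (x # q @ [y]))"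
      using walk_edges_rev[of "x # q @ [y]"] by simp
    have "cycle_list ?D1"
      using bq dist disj q(5) by (cases b; cases q) (auto simp: cycle_list_def)
    moreover have "cycle_edges ?D1 \<subseteq> E"
      using cycle_edges_split[of x b y "rev q"] rq xq ce C(2) by auto
    ultimately have n1: "nbrs \<subseteq> set ?D1"
      using nbrs_subset[of ?D1 x] qR CR bc x by auto
    have "cycle_list ?D2"
      using cq dist disj q(5) by (cases c; cases q) (auto simp: cycle_list_def)
    moreover have "cycle_edges ?D2 \<subseteq> E"
      using cycle_edges_split[of y c x q] xq ce C(2) by auto
    ultimately have n2: "nbrs \<subseteq> set ?D2"
      using nbrs_subset[of ?D2 x] qR CR bc x by auto
    have "nbrs \<subseteq> {x, y}"
    proof
      fix v assume v: "v \<in> nbrs"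
      then have "v \<notin> set q" using nbrs_C q(4) by blast
      moreover have "v \<in> set ?D1" "v \<in> set ?D2" using n1 n2 v by blast+
      ultimately show "v \<in> {x, y}" using dist by auto
    qed
    \<comment> \<open>\<open>g\<close> is the last edge of the path. It supplies an extra edge at
      \<open>y\<close> for the degree count in \<open>C_subset_nbrs\<close>.\<close>
    moreover have "\<exists>g\<in>E. y \<in> g \<and> g \<notin> cycle_edges C \<and> g \<inter> R = {}"
    proof (cases "q = []")
      case True
      then show ?thesis using q(2) xz zR xR by (intro bexI[of _ "{x, z}"]) auto
    next
      case False
      have "{last q, y} \<in> E" using xq False walk_edges_snoc[of "x # q" y] by auto
      moreover have "{last q, y} \<notin> cycle_edges C"
      proof
        assume "{last q, y} \<in> cycle_edges C"
        then have "last q \<in> set C" using cycle_edges_subset by fastforce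
        then show False using last_in_set[OF False] q(4) by blast
      qed
      moreover have "{last q, y} \<inter> R = {}" using qR q(3) R(3) last_in_set[OF False] by blast
      ultimately show ?thesis by blast
    qed
    ultimately show ?thesis using that[of y] q(3) by blast
  qed
qed

text \<open>If \<open>x\<close> had no neighbour in \<open>R\<close>, \<open>ear\<close> would leave
  \<open>y\<close> as the only vertex of \<open>nbrs\<close>. As there are no bridges, two edges
  join \<open>y\<close> to \<open>R\<close>; with \<open>g\<close> and the two edges of
  \<open>C\<close> this gives degree at least 5.\<close>

lemma C_subset_nbrs: "set C \<subseteq> nbrs"
proof
  fix x assume x: "x \<in> set C"
  show "x \<in> nbrs"
  proof (rule ccontr)
    assume xn: "x \<notin> nbrs"
    obtain z where z: "{x, z} \<in> E" "{x, z} \<notin> cycle_edges C"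
      using off_cycle_edge[OF C x] .
    have xR: "x \<notin> R" using x R(3) by auto
    then have "z \<notin> R" using xn z(1) by (auto simp: nbrs_def insert_commute)
    then obtain y where y: "y \<in> set C" "nbrs \<subseteq> {x, y}"
      "y \<noteq> x \<Longrightarrow> \<exists>g\<in>E. y \<in> g \<and> g \<notin> cycle_edges C \<and> g \<inter> R = {}"
      using ear[OF x z] by metis
    have nb: "nbrs = {y}" using y(2) xn nbrs_nonempty by auto
    then have "y \<noteq> x" using xn by auto
    then obtain g where g: "g \<in> E" "y \<in> g" "g \<notin> cycle_edges C" "g \<inter> R = {}"
      using y(3) by blast
    have yR: "y \<notin> R" using y(1) R(3) by auto
    obtain r where r: "r \<in> R" "{r, y} \<in> E" using nb by (auto simp: nbrs_def)
    obtain s t where s: "{s, t} \<in> E - {{r, y}}" "s \<in> R" "t \<notin> R"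
      using conn_exit[OF no_bridge[OF r(2)] r(1) yR] by blast
    then have "t \<in> nbrs" by (auto simp: nbrs_def)
    then have t: "t = y" using nb by simp
    have off: "e \<notin> cycle_edges C" if "u \<in> e" "u \<in> R" for e u
      using cycle_edges_subset[of e C] that R(3) by auto
    have "card {{r, y}, {s, y}, g} \<le> degree (E - cycle_edges C) y"
    proof (rule degree_ge_card)
      show "{{r, y}, {s, y}, g} \<subseteq> E - cycle_edges C"
        using r s t g off[of r "{r, y}"] off[of s "{s, y}"] by auto
    qed (use finE g in auto)
    moreover have "card {{r, y}, {s, y}, g} = 3"
    proof -
      have "{r, y} \<noteq> g" "{s, y} \<noteq> g" using g(4) r(1) s(2) by auto
      moreover have "{r, y} \<noteq> {s, y}" using s(1) t by auto
      ultimately show ?thesis by simp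
    qed
    ultimately show False
      using degree_Diff[OF C(2), of y] cycle_degree[OF C(1) y(1)] deg4[of y] by simp
  qed
qed

section \<open>Bridges of the graph without the edges of the cycle\<close>

definition H :: "'a set set" where "H = E - cycle_edges C"

lemma H_E: "H \<subseteq> E" by (auto simp: H_def)

lemma inside_H: "{e \<in> E. e \<subseteq> R} \<subseteq> H"
proof
  fix e assume e: "e \<in> {e \<in> E. e \<subseteq> R}"
  then obtain x where "x \<in> e" using edge[of e] by fastforce
  then show "e \<in> H" using e cycle_edges_subset[of e C] R(3) by (auto simp: H_def)
qed

lemma attached:
  assumes "x \<in> set C"
  obtains r where "r \<in> R" "{x, r} \<in> H"
proof -
  have "x \<in> nbrs" using C_subset_nbrs assms by auto
  then obtain r where r: "r \<in> R" "{r, x} \<in> E" by (auto simp: nbrs_def)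
  then have "{x, r} \<in> H"
    using cycle_edges_subset[of "{x, r}" C] R(3) by (auto simp: H_def insert_commute)
  then show ?thesis using that r by blast
qed

text \<open>Every vertex of \<open>C\<close> has a neighbour in the connected set \<open>R\<close>.
  These paths keep \<open>C\<close> connected in \<open>H\<close> and serve to reroute
  \<open>C\<close>.\<close>

lemma path_through_R:
  assumes "x \<in> set C" "y \<in> set C"
  obtains p where "p \<noteq> []" "set p \<subseteq> R" "distinct p" "set (walk_edges (x # p @ [y])) \<subseteq> H"
proof -
  obtain r where r: "r \<in> R" "{x, r} \<in> H" using attached[OF assms(1)] .
  obtain s where s: "s \<in> R" "{y, s} \<in> H" using attached[OF assms(2)] .
  obtain p where p: "p \<noteq> []" "hd p = r" "last p = s" "distinct p"
    "set (walk_edges p) \<subseteq> {e \<in> E. e \<subseteq> R}"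
    using conn_obtain_path[OF R(4)[OF r(1) s(1)]] .
  have "set p \<subseteq> R"
  proof
    fix v assume "v \<in> set p"
    moreover have "r \<in> set p" using p(1,2) by auto
    ultimately have "conn {e \<in> E. e \<subseteq> R} r v" using conn_walk[OF p(5)] by blast
    then show "v \<in> R" by (rule conn_closed) (use r(1) in auto)
  qed
  moreover have "walk_edges (x # p @ [y]) = {x, r} # walk_edges p @ [{s, y}]"
    using p(1-3) by (simp add: walk_edges_Cons walk_edges_snoc)
  then have "set (walk_edges (x # p @ [y])) \<subseteq> H"
    using p(5) inside_H r(2) s(2) by (auto simp: insert_commute)
  ultimately show ?thesis using that p by blast
qed

lemma conn_H: "x \<in> set C \<Longrightarrow> y \<in> set C \<Longrightarrow> conn H x y"
  using path_through_R[of x y] conn_walk[of "x # _ @ [y]" H x y]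
  by (metis in_set_conv_decomp list.set_intros append_Cons)

text \<open>In \<open>H\<close> the vertices \<open>x\<close> and \<open>y\<close> are connected, so
  some edge of \<open>H\<close> leaves the component of \<open>x\<close> in \<open>H - {b}\<close>,
  and only \<open>b\<close> can.\<close>

lemma bridge_of_component:
  assumes "x \<in> set C" "y \<in> set C" "\<not> conn (H - {b}) x y"
  obtains s t where "b = {s, t}" "conn (H - {b}) x s" "\<not> conn (H - {b}) x t" "b \<in> H"
proof -
  obtain s t where st: "{s, t} \<in> H" "conn (H - {b}) x s" "\<not> conn (H - {b}) x t"
    using conn_exit[OF conn_H[OF assms(1,2)], of "{v. conn (H - {b}) x v}"] assms(3) by auto
  have "b = {s, t}"
  proof (rule ccontr)
    assume "b \<noteq> {s, t}"
    then have "conn (H - {b}) s t" using st(1) by (intro conn_edge) auto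
    then show False using st(2,3) conn_trans by metis
  qed
  then show ?thesis using that st by blast
qed

text \<open>
  The part of \<open>H\<close> between two bridges separating \<open>x\<close> from \<open>y\<close> would be cut off by removing the cycle
  that arises from \<open>C\<close> by replacing the edge \<open>{x, y}\<close> with a path through \<open>R\<close>.
\<close>

lemma unique_bridge:
  assumes a: "cycle_list (x # a)" "cycle_edges (x # a) = cycle_edges C" "set (x # a) = set C"
    and y: "y = last a"
    and b: "b1 \<noteq> b2" "\<not> conn (H - {b1}) x y" "\<not> conn (H - {b2}) x y"
  shows False
proof -
  obtain a' where a': "a = a' @ [y]" "a' \<noteq> []"
  proof -
    have len: "length a \<ge> 2" using a(1) by (simp add: cycle_list_def)
    then have "a \<noteq> []" by auto
    then have "a = butlast a @ [y]" using y by simp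
    moreover have "length (butlast a) > 0" using len by simp
    ultimately show ?thesis using that[of "butlast a"] by blast
  qed
  have xy: "x \<in> set C" "y \<in> set C" using a(3) a' by auto
  obtain p where p: "p \<noteq> []" "set p \<subseteq> R" "distinct p" "set (walk_edges (x # p @ [y])) \<subseteq> H"
    using path_through_R[OF xy] .
  \<comment> \<open>The cycle \<open>C\<close> with its edge \<open>{x, y}\<close> replaced by the
    path through \<open>R\<close>.\<close>
  define D where "D = x # a' @ y # rev p"
  have rp: "set (walk_edges (y # rev p @ [x])) = set (walk_edges (x # p @ [y]))"
    using walk_edges_rev[of "x # p @ [y]"] by simp
  have ceD: "cycle_edges D = set (walk_edges (x # a)) \<union> set (walk_edges (x # p @ [y]))"
    unfolding D_def using cycle_edges_split[of x a' y "rev p"] rp a' by simp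
  have ceC: "cycle_edges C = insert {x, y} (set (walk_edges (x # a)))"
    using a(2) a' cycle_edges_split[of x a' y "[]"] by (auto simp: insert_commute)
  have D: "cycle_list D"
    using a(1,3) a' p(2,3) R(3) by (cases a') (auto simp: D_def cycle_list_def)
  have DE: "cycle_edges D \<subseteq> E" using ceD ceC C(2) p(4) H_E by auto
  have onpath: "c \<in> set (walk_edges (x # p @ [y]))" if "\<not> conn (H - {c}) x y" for c
  proof (rule ccontr)
    assume "c \<notin> set (walk_edges (x # p @ [y]))"
    then have "set (walk_edges (x # p @ [y])) \<subseteq> H - {c}" using p(4) by auto
    then have "conn (H - {c}) x y" by (rule conn_walk) auto
    then show False using that by simp
  qed
  \<comment> \<open>Both bridges lie on the path through \<open>R\<close>, so they disappear with
    \<open>D\<close>; of \<open>C\<close> only the edge \<open>{x, y}\<close> remains.\<close>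
  have rest: "E - cycle_edges D \<subseteq> insert {x, y} (H - {b1, b2})"
    using ceD ceC onpath b(2,3) by (auto simp: H_def)
  define A where "A b = {v. conn (H - {b}) x v}" for b
  have closed: "v \<in> A b" if "{u, v} \<in> H" "{u, v} \<noteq> b" "u \<in> A b" for u v b
  proof -
    have "conn (H - {b}) u v" using that(1,2) by (intro conn_edge) auto
    then show ?thesis using that(3) by (auto simp: A_def intro: conn_trans)
  qed
  have xA: "x \<in> A b1" "x \<in> A b2" and yA: "y \<notin> A b1" "y \<notin> A b2"
    using b by (auto simp: A_def)
  \<comment> \<open>\<open>b1\<close> leaves \<open>A b1\<close>, but only \<open>b2\<close> can
    leave \<open>A b2\<close>.\<close>
  have "A b1 \<noteq> A b2"
  proof
    assume eq: "A b1 = A b2"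
    obtain s t where st: "b1 = {s, t}" "s \<in> A b1" "t \<notin> A b1" "b1 \<in> H"
      using bridge_of_component[OF xy b(2)] unfolding A_def by blast
    then show False using closed[of s t b2] eq b(1) by auto
  qed
  \<comment> \<open>The part between the bridges: \<open>x\<close> lies on both sides
    \<open>A b1\<close> and \<open>A b2\<close> and \<open>y\<close> on neither, so
    \<open>{x, y}\<close> does not touch \<open>W\<close>.\<close>
  define W where "W = (A b1 - A b2) \<union> (A b2 - A b1)"
  obtain v where v: "v \<in> W" using \<open>A b1 \<noteq> A b2\<close> by (auto simp: W_def)
  have "\<not> conn (E - cycle_edges D) v x"
  proof
    assume "conn (E - cycle_edges D) v x"
    then have "x \<in> W"
    proof (rule conn_closed)
      fix u w assume uw: "{u, w} \<in> E - cycle_edges D" "u \<in> W"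
      have "{u, w} \<noteq> {x, y}" using uw(2) xA yA by (auto simp: W_def doubleton_eq_iff)
      then have e: "{u, w} \<in> H" "{u, w} \<noteq> b1" "{u, w} \<noteq> b2" using uw(1) rest by auto
      then have e': "{w, u} \<in> H" "{w, u} \<noteq> b1" "{w, u} \<noteq> b2" by (simp_all add: insert_commute)
      show "w \<in> W" using uw(2) closed[OF e(1,2)] closed[OF e(1,3)]
          closed[OF e'(1,2)] closed[OF e'(1,3)] unfolding W_def by blast
    qed (rule v)
    then show False using xA by (auto simp: W_def)
  qed
  moreover have "conn E x v"
    using v H_E unfolding W_def A_def by (auto elim!: conn_mono)
  ultimately show False
    using no_gain_cycle[OF D DE, of x v] conn_sym cycle_V[OF C xy(1)] by metis
qed

text \<open>
  A closed trail through two vertices of \<open>C\<close> would gain: removing it together with \<open>C\<close> isolates both,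
  as well as every vertex at which the trail has degree 4.
\<close>

lemma ex_bridge:
  assumes uv: "u \<in> set C" "v \<in> set C" "u \<noteq> v"
  shows "\<exists>b\<in>H. \<not> conn (H - {b}) u v"
proof (rule ccontr)
  assume "\<not> ?thesis"
  then obtain w where w: "closed_trail w" "set (walk_edges w) \<subseteq> H" "u \<in> set w" "v \<in> set w"
    using closed_trail_through[of H u v] conn_H[OF uv(1,2)] uv(3) edge H_E by blast
  define X where "X = set (walk_edges w)"
  define F where "F = {z. degree X z = 4}"
  have XH: "X \<subseteq> H" using w(2) by (simp add: X_def)
  have deg: "degree (cycle_edges C) z + degree X z + degree (H - X) z \<le> 4" for z
    using degree_Diff[OF C(2), of z] degree_Diff[OF XH H_E, of z] deg4[of z] by (simp add: H_def)
  have "degree X z \<le> 4" for z using deg[of z] by simp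
  then have "decomposable X (Suc (card F))"
    unfolding X_def F_def by (rule decomposable_closed_trail[OF w(1)])
  moreover have "cycle_edges C \<inter> X = {}" using XH by (auto simp: H_def)
  ultimately have "decomposable (cycle_edges C \<union> X) (1 + Suc (card F))"
    by (intro decomposable_Un decomposable_cycle C(1))
  moreover have "cycle_edges C \<union> X = E - (H - X)" using XH C(2) by (auto simp: H_def)
  ultimately have dec: "decomposable (E - (H - X)) (1 + Suc (card F))" by simp
  obtain t where t: "t \<in> set C" "t \<noteq> u" "t \<noteq> v"
  proof -
    have "\<not> set C \<subseteq> {u, v}"
    proof
      assume "set C \<subseteq> {u, v}"
      then have "card (set C) \<le> card {u, v}" by (intro card_mono) auto
      then show False using card_cycle[OF C(1)] uv(3) by simp
    qed
    then show ?thesis using that by blast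
  qed
  have notF: "z \<notin> F" if "z \<in> set C" for z
    using cycle_degree[OF C(1) that] deg[of z] by (auto simp: F_def)
  have Fw: "F \<subseteq> set w"
  proof
    fix z assume "z \<in> F"
    then have "{e \<in> X. z \<in> e} \<noteq> {}" by (intro notI) (simp add: F_def degree_def)
    then show "z \<in> set w" using walk_edges_subset[of _ w] unfolding X_def by blast
  qed
  \<comment> \<open>At a vertex of \<open>F\<close> the trail uses all four edges; at
    \<open>u\<close> and \<open>v\<close> the cycle and the trail use two each.\<close>
  have iso: "degree (H - X) z = 0" if "z \<in> F \<union> {u, v}" for z
  proof (cases "z \<in> F")
    case True
    then show ?thesis using deg[of z] by (simp add: F_def)
  next
    case False
    then have "z \<in> set C" "z \<in> set w" using that uv w by auto
    then show ?thesis
      using deg[of z] cycle_degree[OF C(1), of z] closed_trail_degree[OF w(1), of z]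
      by (simp add: X_def)
  qed
  \<comment> \<open>The third vertex \<open>t\<close> of \<open>C\<close> stands for one further
    component. No vertex of \<open>C\<close> is in \<open>F\<close>, so \<open>T\<close> has
    \<open>3 + card F\<close> elements against \<open>2 + card F\<close> removed pieces.\<close>
  define T where "T = insert t (insert u (insert v F))"
  have conn_u: "conn E u z" if "z \<in> T" for z
  proof (cases "z \<in> set w")
    case True
    have "conn H u z" using conn_walk[OF w(2,3) True] .
    then show ?thesis by (rule conn_mono) (rule H_E)
  next
    case False
    then have "z = t" using that Fw w by (auto simp: T_def)
    then show ?thesis using cycle_conn[OF uv(1) t(1) C(2)] by simp
  qed
  show False
  proof (rule no_gain[OF _ dec])
    have "H \<subset> E"
    proof -
      have "cycle_edges C \<noteq> {}"
        using C(1) by (intro cycle_edges_nonempty) (auto simp: cycle_list_def)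
      then show ?thesis using C(2) unfolding H_def by blast
    qed
    then show "H - X \<subset> E" by auto
    show "T \<subseteq> V" using conn_u conn_V cycle_V[OF C uv(1)] by blast
    show "conn E x y" if "x \<in> T" "y \<in> T" for x y
      using conn_common[OF conn_u[OF that(1)] conn_u[OF that(2)]] .
    have fin: "finite (H - X)" using finE H_E finite_subset by blast
    show "separated (H - X) T"
      unfolding separated_def
    proof (intro ballI impI)
      fix x y assume xy: "x \<in> T" "y \<in> T" "conn (H - X) x y"
      consider "x \<in> F \<union> {u, v}" | "y \<in> F \<union> {u, v}" | "x = t" "y = t"
        using xy(1,2) by (auto simp: T_def)
      then show "x = y"
      proof cases
        case 1
        then show ?thesis using degree_0_conn[OF fin iso xy(3)] by simp
      next
        case 2
        then show ?thesis using degree_0_conn[OF fin iso conn_sym[OF xy(3)]] by simp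
      qed simp
    qed
    have "finite F" using Fw finite_subset by auto
    then have "card T = 3 + card F"
      using t uv notF by (simp add: T_def)
    then show "Suc (1 + Suc (card F)) \<le> card T" by simp
  qed
qed

text \<open>A bridge cutting off a minimal part of \<open>H\<close> that meets \<open>C\<close> cuts off a single vertex of \<open>C\<close>.\<close>

lemma ex_bridge_isolating:
  "\<exists>x\<in>set C. \<exists>b\<in>H. \<forall>u\<in>set C. conn (H - {b}) x u \<longrightarrow> u = x"
proof -
  define A where "A = (\<lambda>(x, b). {v. conn (H - {b}) x v})"
  define P where "P = (\<lambda>(x, b). x \<in> set C \<and> b \<in> H \<and> (\<exists>u\<in>set C. \<not> conn (H - {b}) x u))"
  have finA: "finite (A (x, b))" if "x \<in> set C" for x b
  proof (rule finite_subset[OF _ finV])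
    show "A (x, b) \<subseteq> V"
    proof
      fix v assume "v \<in> A (x, b)"
      then have "conn (H - {b}) x v" by (simp add: A_def)
      then have "conn E x v" by (rule conn_mono) (use H_E in auto)
      then show "v \<in> V" using conn_V cycle_V[OF C that] by blast
    qed
  qed
  have "\<exists>xb. P xb"
  proof -
    obtain u v where "u \<in> set C" "v \<in> set C" "u \<noteq> v"
      using C(1) by (cases C; cases "tl C") (auto simp: cycle_list_def)
    then show ?thesis using ex_bridge unfolding P_def by fastforce
  qed
  then obtain xb where xb: "P xb" "\<And>yc. P yc \<Longrightarrow> card (A xb) \<le> card (A yc)"
    using ex_has_least_nat[of P _ "\<lambda>xb. card (A xb)"] by metis
  obtain x b where xb_eq: "xb = (x, b)" by (cases xb)
  have x: "x \<in> set C" and b: "b \<in> H" using xb(1) by (auto simp: xb_eq P_def)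
  obtain y where y: "y \<in> set C" "\<not> conn (H - {b}) x y" using xb(1) by (auto simp: xb_eq P_def)
  obtain s t where st: "b = {s, t}" "conn (H - {b}) x s" "\<not> conn (H - {b}) x t"
    using bridge_of_component[OF x y] by metis
  have False if u: "u \<in> set C" "conn (H - {b}) x u" "u \<noteq> x" for u
  proof -
    obtain b' where b': "b' \<in> H" "\<not> conn (H - {b'}) x u" using ex_bridge[OF x u(1)] u(3) by blast
    \<comment> \<open>\<open>s\<close> is the end of \<open>b\<close> on the side of
      \<open>x\<close>. A side of \<open>b'\<close> that starts within \<open>A (x, b)\<close> and
      misses \<open>s\<close> cannot cross \<open>b\<close>, so it is strictly smaller. As
      \<open>b'\<close> separates \<open>x\<close> from \<open>u\<close>, one of their sides misses
      \<open>s\<close>.\<close>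
    have smaller_side: False
      if v: "v \<in> set C" "conn (H - {b}) x v" "P (v, b')" "\<not> conn (H - {b'}) v s" for v
    proof -
      have "A (v, b') \<subset> A (x, b)"
      proof
        show "A (v, b') \<subseteq> A (x, b)"
        proof
          fix z assume "z \<in> A (v, b')"
          then have "conn (H - {b'}) v z" by (simp add: A_def)
          then have "z \<in> A (v, b') \<inter> A (x, b)"
          proof (rule conn_closed)
            show "v \<in> A (v, b') \<inter> A (x, b)" using v(2) by (simp add: A_def)
            fix c d assume cd: "{c, d} \<in> H - {b'}" "c \<in> A (v, b') \<inter> A (x, b)"
            have "conn (H - {b'}) v d"
              using cd(2) conn_trans[OF _ conn_edge[OF cd(1)]] by (simp add: A_def)
            moreover have "{c, d} \<noteq> b"
            proof
              assume "{c, d} = b"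
              then have "c = s \<or> c = t" using st(1) by auto
              then show False using cd(2) st(3) v(4) by (auto simp: A_def)
            qed
            then have "conn (H - {b}) c d" using cd(1) by (intro conn_edge) auto
            then have "conn (H - {b}) x d" using cd(2) by (auto simp: A_def intro: conn_trans)
            ultimately show "d \<in> A (v, b') \<inter> A (x, b)" by (simp add: A_def)
          qed
          then show "z \<in> A (x, b)" by simp
        qed
        show "A (v, b') \<noteq> A (x, b)" using st(2) v(4) by (auto simp: A_def)
      qed
      then have "card (A (v, b')) < card (A (x, b))" using finA[OF x] psubset_card_mono by blast
      then show False using xb(2)[OF v(3)] by (simp add: xb_eq)
    qed
    have "P (x, b')" "P (u, b')"
      using x u(1) b' conn_sym[of _ u x] by (auto simp: P_def)
    moreover have "\<not> conn (H - {b'}) x s \<or> \<not> conn (H - {b'}) u s"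
      using b'(2) conn_sym conn_trans by metis
    ultimately show False
      using smaller_side[OF x conn_refl] smaller_side[OF u(1,2)] by blast
  qed
  then show ?thesis using x b by blast
qed

lemma contradiction: False
proof -
  obtain x b where x: "x \<in> set C" "b \<in> H"
    and alone: "\<And>u. u \<in> set C \<Longrightarrow> conn (H - {b}) x u \<Longrightarrow> u = x"
    using ex_bridge_isolating by blast
  obtain a where a: "cycle_list (x # a)" "cycle_edges (x # a) = cycle_edges C" "set (x # a) = set C"
    using cycle_rotate_to[OF C(1) x(1)] .
  \<comment> \<open>Reversing the cycle lets \<open>unique_bridge\<close>, which speaks of the last
    vertex, apply to the other neighbour of \<open>x\<close>.\<close>
  have ra: "cycle_list (x # rev a)" "cycle_edges (x # rev a) = cycle_edges C"
    "set (x # rev a) = set C"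
    using a walk_edges_rev[of "x # a @ [x]"] by (auto simp: cycle_list_def cycle_edges_Cons)
  have ne: "a \<noteq> []" "x \<notin> set a" using a(1) by (auto simp: cycle_list_def)
  define y z where "y = last a" and "z = last (rev a)"
  have yz: "y \<in> set C" "z \<in> set C" "y \<noteq> x" "z \<noteq> x"
  proof -
    have "y \<in> set a" "z \<in> set a" using ne(1) by (auto simp: y_def z_def last_rev)
    moreover have "set a \<subseteq> set C" unfolding a(3)[symmetric] by auto
    ultimately show "y \<in> set C" "z \<in> set C" "y \<noteq> x" "z \<noteq> x" using ne(2) by auto
  qed
  have "y \<noteq> z"
    using a(1) unfolding y_def z_def cycle_list_def by (cases a) (auto simp: last_rev)
  have sep: "\<not> conn (H - {b}) x y" "\<not> conn (H - {b}) x z" using alone yz by auto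
  obtain b' where b': "b' \<in> H" "\<not> conn (H - {b'}) y z"
    using ex_bridge[OF yz(1,2) \<open>y \<noteq> z\<close>] by blast
  show False
  proof (cases "b' = b")
    case False
    then have "conn (H - {b'}) x y" "conn (H - {b'}) x z"
      using unique_bridge[OF a y_def, of b b'] unique_bridge[OF ra z_def, of b b'] sep by auto
    then show False using b'(2) conn_sym conn_trans by metis
  next
    case True
    obtain s t where st: "b = {s, t}" "conn (H - {b}) x s" "\<not> conn (H - {b}) x t"
      using bridge_of_component[OF x(1) yz(1) sep(1)] by metis
    \<comment> \<open>Every vertex of \<open>C\<close> not on the side of \<open>x\<close> lies on
      the side of \<open>t\<close>, the other end of \<open>b\<close>; this holds for both
      \<open>y\<close> and \<open>z\<close>.\<close>
    have far: "conn (H - {b}) v t" if v: "v \<in> set C" "\<not> conn (H - {b}) x v" for v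
    proof -
      have "\<not> conn (H - {b}) v x" using v(2) conn_sym by metis
      then obtain s' t' where s't': "b = {s', t'}" "conn (H - {b}) v s'"
        using bridge_of_component[OF v(1) x(1)] by metis
      have "s' \<noteq> s" using s't'(2) st(2) v(2) conn_sym conn_trans by metis
      then have "s' = t" using s't'(1) st(1) by (auto simp: doubleton_eq_iff)
      then show ?thesis using s't'(2) by simp
    qed
    have "conn (H - {b}) y z"
      using far[OF yz(1) sep(1)] far[OF yz(2) sep(2)] conn_sym conn_trans by metis
    then show False using b'(2) True by simp
  qed
qed

end

section \<open>Induction on the number of edges and conclusion\<close>

lemma (in minimal_counterexample) absurd: False
proof -
  obtain C0 R0 where "admissible C0 R0" using ex_admissible by blast
  \<comment> \<open>The bound guarantees that a pair with largest \<open>R\<close> exists.\<close>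
  moreover have "card R \<le> card V" if "admissible C R" for C R
    using that finV by (auto simp: admissible_def intro: card_mono)
  ultimately obtain CR where "admissible (fst CR) (snd CR)"
    "\<And>DQ. admissible (fst DQ) (snd DQ) \<Longrightarrow> card (snd DQ) \<le> card (snd CR)"
    using ex_has_greatest_nat[of "\<lambda>CR. admissible (fst CR) (snd CR)" "(C0, R0)"
        "\<lambda>CR. card (snd CR)" "Suc (card V)"] by (auto simp: less_Suc_eq_le)
  then interpret maximal_pair V E S "fst CR" "snd CR"
    by unfold_locales (simp, metis fst_conv snd_conv)
  show False by (rule contradiction)
qed

text \<open>\<open>S\<close> varies in the induction because \<open>no_gain\<close> passes to a
  larger separated set.\<close>

lemma decomposable_separated:
  assumes "finite V" "\<And>e. e \<in> E \<Longrightarrow> e \<subseteq> V \<and> card e = 2" "\<And>v. degree E v \<le> 4"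
    and "S \<subseteq> V" "separated E S"
  shows "decomposable E (card V - card S)"
  using assms
proof (induction "card E" arbitrary: E S rule: less_induct)
  case less
  have finE: "finite E"
    using less.prems(1,2) by (meson PowI finite_Pow_iff rev_finite_subset subsetI)
  show ?case
  proof (rule ccontr)
    assume n: "\<not> ?case"
    interpret minimal_counterexample V E S
    proof
      fix E' S' assume E': "E' \<subset> E" "S' \<subseteq> V" "separated E' S'"
      show "decomposable E' (card V - card S')"
      proof (rule less.hyps)
        show "card E' < card E" using E'(1) finE psubset_card_mono by blast
        show "degree E' v \<le> 4" for v
          using degree_mono[of E E' v] finE E'(1) less.prems(3)[of v] by auto
        show "e \<subseteq> V \<and> card e = 2" if "e \<in> E'" for e
          using that E'(1) less.prems(2)[of e] by blast
      qed (use less.prems(1) E' in auto)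
    qed (use less.prems n in auto)
    show False by (rule absurd)
  qed
qed

theorem theorem1p3:
  fixes V :: "'a set" and E :: "'a set set" and n :: nat
  assumes "simple_graph V E"
    and "card V = n"
    and "max_degree V E \<le> 4"
  shows "f_ce E \<le> n - 1 \<and> (\<exists>P. ce_decomposition E P \<and> card P \<le> n - 1)"
proof -
  interpret simple_graph V E by fact
  obtain v where v: "v \<in> V" using verts_nonempty by blast
  have "degree E u \<le> 4" for u
  proof (cases "u \<in> V")
    case True
    then have "degree E u \<le> max_degree V E"
      unfolding max_degree_def using finite_verts by (intro Max_ge) auto
    then show ?thesis using assms(3) by simp
  next
    case False
    then have none: "{e \<in> E. u \<in> e} = {}" using edges by blast
    show ?thesis unfolding degree_def none by simp
  qed
  \<comment> \<open>A single vertex is always separated, which gives \<open>n - 1\<close>.\<close>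
  then have "decomposable E (card V - card {v})"
    using finite_verts edges v by (intro decomposable_separated) (auto simp: separated_def)
  then obtain P where "ce_decomposition E P" "card P \<le> n - 1"
    using assms(2) by (auto simp: decomposable_def)
  then show ?thesis using f_ce_le le_trans by blast
qed

end
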